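(* There is an absolute constant $C>0$ such that the following holds. Let $n\ge 1$, let $\mathcal{F}\subseteq S_n$ with $|\mathcal{F}|=c\cdot n!$ where $0<c<1$, let $f=2\chi_{\mathcal F}-1$, let $f_1$ be the orthogonal projection of $f$ onto $U_1$, and let $\epsilon=\mathbb{E}[(f-f_1)^2]$. Then there exists a family $\mathcal{G}\subseteq S_n$ which is a union of $dn$ pairwise disjoint 1-cosets, such that \[ |d-c|\le C\left(\epsilon^{1/7}+\frac{1}{n^{1/3}}\right)\quad\text{and}\quad \frac{|\mathcal G\,\triangle\,\mathcal F|}{n!}\le \frac{C}{\eta}\left(\epsilon^{1/7}+\frac{1}{n^{1/3}}\right), \] where $\eta=\min\{c,1-c\}$.
   Context: $S_n$ is the symmetric group on $[n]=\{1,\dots,n\}$. For $i,j\in[n]$, the 1-coset $T_{ij}=\{\pi\in S_n:\pi(i)=j\}$; we also write $T_{ij}$ for its indicator function. $U_1$ is the subspace of $\mathbb{R}^{S_n}$ spanned by $\{T_{ij}: i,j\in[n]\}$. $\mathbb{R}^{S_n}$ carries the inner product $\langle f,g\rangle=\frac1{n!}\sum_{\pi\in S_n}f(\pi)g(\pi)$, and $\mathbb{E}$ denotes expectation under the uniform probability measure on $S_n$. $\chi_{\mathcal F}$ is the indicator function of $\mathcal F$. *)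

theory Defs
  imports "HOL-Combinatorics.Permutations" Complex_Main
begin

definition Sn :: "nat \<Rightarrow> (nat \<Rightarrow> nat) set" where
  "Sn n = {p. p permutes {1..n}}"

definition coset1 :: "nat \<Rightarrow> nat \<Rightarrow> nat \<Rightarrow> (nat \<Rightarrow> nat) set" where
  "coset1 n i j = {p \<in> Sn n. p i = j}"

definition T :: "nat \<Rightarrow> nat \<Rightarrow> nat \<Rightarrow> (nat \<Rightarrow> nat) \<Rightarrow> real" where
  "T n i j = (\<lambda>p. if p \<in> coset1 n i j then 1 else 0)"

definition U1 :: "nat \<Rightarrow> ((nat \<Rightarrow> nat) \<Rightarrow> real) set" where
  "U1 n = {g. \<exists>a :: nat \<Rightarrow> nat \<Rightarrow> real.
              g = (\<lambda>p. \<Sum>i\<in>{1..n}. \<Sum>j\<in>{1..n}. a i j * T n i j p)}"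

definition ip :: "nat \<Rightarrow> ((nat \<Rightarrow> nat) \<Rightarrow> real) \<Rightarrow> ((nat \<Rightarrow> nat) \<Rightarrow> real) \<Rightarrow> real" where
  "ip n f g = (\<Sum>p\<in>Sn n. f p * g p) / fact n"

definition expect :: "nat \<Rightarrow> ((nat \<Rightarrow> nat) \<Rightarrow> real) \<Rightarrow> real" where
  "expect n f = (\<Sum>p\<in>Sn n. f p) / fact n"

definition is_proj_U1 :: "nat \<Rightarrow> ((nat \<Rightarrow> nat) \<Rightarrow> real) \<Rightarrow> ((nat \<Rightarrow> nat) \<Rightarrow> real) \<Rightarrow> bool" where
  "is_proj_U1 n f f1 \<longleftrightarrow> f1 \<in> U1 n \<and> (\<forall>g\<in>U1 n. ip n (\<lambda>p. f p - f1 p) g = 0)"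

definition chi :: "(nat \<Rightarrow> nat) set \<Rightarrow> (nat \<Rightarrow> nat) \<Rightarrow> real" where
  "chi F p = (if p \<in> F then 1 else 0)"

end

theory Submission
  imports Defs
begin

text \<open>
  Write the projection as \<open>f\<^sub>1 = \<kappa> + \<Sum>\<^sub>i b\<^bsub>i \<pi>(i)\<^esub>\<close> with all row and column sums of \<open>b\<close> zero. Then
  \<open>(\<Sum> b\<^sup>2) / (n - 1) = 1 - \<kappa>\<^sup>2 - \<epsilon>\<close>, and \<open>b\<^bsub>i j\<^esub>\<close> is, up to the factor \<open>1 - 1/n\<close>, the deviation of the
  mean of \<open>f\<close> on \<open>T\<^bsub>i j\<^esub>\<close> from \<open>\<kappa>\<close>. By the law of total variance \<open>f\<close> is close to a union of cosets
  from row \<open>i\<close> as soon as that row carries almost all of \<open>\<Sum> b\<^sup>2\<close>.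

  Split \<open>[n]\<close> into two halves \<open>A\<close>, \<open>B\<close>. On a coset of \<open>S\<^sub>A \<times> S\<^sub>B\<close> the function \<open>f\<^sub>1\<close> has the form
  \<open>u(x) + v(y)\<close>, and a \<open>\<plusminus>1\<close>-valued function can be approximated by such a sum only if the variance
  of \<open>u\<close> or of \<open>v\<close> is small. These variances are essentially the sums of \<open>b\<^sup>2\<close> over the two diagonal
  blocks of the coset, so averaging over all cosets bounds the sum of \<open>b\<^bsub>i j\<^esub>\<^sup>2 b\<^bsub>k l\<^esub>\<^sup>2\<close> over \<open>i \<noteq> k\<close>,
  \<open>j \<noteq> l\<close> by \<open>O(\<epsilon> + 1/n)\<close>. Hence the mass of \<open>b\<^sup>2\<close> concentrates on a single row or column.
\<close>

section \<open>Averages over permutations\<close>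

text \<open>Means are taken over the symmetric group of an arbitrary set because the argument
  averages over permutations of the ground set and of its two halves side by side.\<close>

definition pavg :: "'a set \<Rightarrow> (('a \<Rightarrow> 'a) \<Rightarrow> real) \<Rightarrow> real" where
  "pavg A g = (\<Sum>p | p permutes A. g p) / fact (card A)"

lemma pavg_cong:
  assumes "\<And>p. p permutes A \<Longrightarrow> g p = h p"
  shows "pavg A g = pavg A h"
  unfolding pavg_def using assms by (intro arg_cong2[where f="(/)"] sum.cong) auto

lemma pavg_add: "pavg A (\<lambda>p. g p + h p) = pavg A g + pavg A h"
  by (simp add: pavg_def sum.distrib add_divide_distrib)

lemma pavg_diff: "pavg A (\<lambda>p. g p - h p) = pavg A g - pavg A h"
  by (simp add: pavg_def sum_subtractf diff_divide_distrib)

lemma pavg_cmult: "pavg A (\<lambda>p. c * g p) = c * pavg A g"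
  by (simp add: pavg_def sum_distrib_left)

lemma pavg_cmult_right: "pavg A (\<lambda>p. g p * c) = pavg A g * c"
  by (simp add: pavg_def sum_distrib_right)

lemma pavg_nonneg: "(\<And>p. p permutes A \<Longrightarrow> 0 \<le> g p) \<Longrightarrow> 0 \<le> pavg A g"
  unfolding pavg_def by (intro divide_nonneg_nonneg sum_nonneg) auto

lemma pavg_divide: "pavg A (\<lambda>p. g p / c) = pavg A g / c"
  using pavg_cmult[of A "1 / c" g] by simp

lemma pavg_const: "finite A \<Longrightarrow> pavg A (\<lambda>p. c) = c"
  by (simp add: pavg_def card_permutations)

lemma pavg_sum: "pavg A (\<lambda>p. \<Sum>i\<in>I. g i p) = (\<Sum>i\<in>I. pavg A (g i))"
  unfolding pavg_def by (subst sum.swap) (simp add: sum_divide_distrib)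

lemma pavg_mono:
  assumes "\<And>p. p permutes A \<Longrightarrow> g p \<le> h p"
  shows "pavg A g \<le> pavg A h"
  unfolding pavg_def by (intro divide_right_mono sum_mono) (use assms in auto)

lemma pavg_commute: "pavg A (\<lambda>p. pavg B (g p)) = pavg B (\<lambda>q. pavg A (\<lambda>p. g p q))"
  unfolding pavg_def sum_divide_distrib[symmetric]
  by (subst sum.swap) (simp add: mult.commute)

section \<open>Translation invariance; one- and two-point marginals of a random permutation\<close>

lemma pavg_compose_right:
  assumes "q permutes A"
  shows "pavg A (\<lambda>p. g (p \<circ> q)) = pavg A g"
  unfolding pavg_def using sum_permutations_compose_right[OF assms, of g] by simp

text \<open>Right translation by a transposition makes the mean independent of the position
  \<open>i\<close>, and the sum over all positions is the constant \<open>\<Sum>j\<in>A. g j\<close>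
  because \<open>p\<close> is a bijection.\<close>

lemma pavg_marginal:
  assumes "finite A" "i \<in> A"
  shows "pavg A (\<lambda>p. g (p i)) = (\<Sum>j\<in>A. g j) / card A"
proof -
  have eq: "pavg A (\<lambda>p. g (p k)) = pavg A (\<lambda>p. g (p i))" if "k \<in> A" for k
    using pavg_compose_right[OF permutes_swap_id[OF assms(2) that], of "\<lambda>p. g (p i)"] by simp
  have "card A * pavg A (\<lambda>p. g (p i)) = (\<Sum>k\<in>A. pavg A (\<lambda>p. g (p k)))"
    using sum.cong[OF refl eq, of A] by simp
  also have "\<dots> = pavg A (\<lambda>p. \<Sum>k\<in>A. g (p k))" by (simp add: pavg_sum)
  also have "\<dots> = pavg A (\<lambda>p. \<Sum>j\<in>A. g j)"
    by (rule pavg_cong) (metis permutes_imp_bij sum.reindex_bij_betw)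
  finally have "card A * pavg A (\<lambda>p. g (p i)) = (\<Sum>j\<in>A. g j)"
    using assms by (simp add: pavg_const)
  moreover have "card A \<noteq> 0" using assms by auto
  ultimately show ?thesis by (simp add: field_simps)
qed

text \<open>Double transitivity: one transposition sends \<open>i\<close> to \<open>k\<close>, a
  second one corrects the image of \<open>i'\<close>. The second fixes \<open>k\<close>, since
  neither that image nor \<open>k'\<close> equals \<open>k\<close>.\<close>

lemma exists_permutes_pair:
  assumes "i \<in> A" "i' \<in> A" "i \<noteq> i'" "k \<in> A" "k' \<in> A" "k \<noteq> k'"
  obtains q where "q permutes A" "q i = k" "q i' = k'"
proof
  let ?s = "transpose i k" and ?t = "transpose (transpose i k i') k'"
  have s: "?s permutes A" using assms by (intro permutes_swap_id)
  hence "?s i' \<in> A" using assms by (simp add: permutes_in_image)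
  hence t: "?t permutes A" using assms by (intro permutes_swap_id)
  show "(?t \<circ> ?s) permutes A" using s t by (rule permutes_compose)
  show "(?t \<circ> ?s) i = k" "(?t \<circ> ?s) i' = k'" using assms
    by (auto simp: transpose_def)
qed

lemma sum_offdiag_permute:
  assumes "p permutes A"
  shows "(\<Sum>k\<in>A. \<Sum>l\<in>A - {k}. g (p k) (p l)) = (\<Sum>j\<in>A. \<Sum>l\<in>A - {j}. g j l)"
proof -
  have b: "bij_betw p A A" using assms by (rule permutes_imp_bij)
  have "(\<Sum>l\<in>A - {k}. g (p k) (p l)) = (\<Sum>l\<in>A - {p k}. g (p k) l)" if "k \<in> A" for k
  proof -
    have "bij_betw p (A - {k}) (A - {p k})"
      using b that inj_on_image_set_diff[of p A A "{k}"]
      by (auto simp: bij_betw_def intro: inj_on_diff)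
    thus ?thesis by (rule sum.reindex_bij_betw)
  qed
  hence "(\<Sum>k\<in>A. \<Sum>l\<in>A - {k}. g (p k) (p l)) = (\<Sum>k\<in>A. \<Sum>l\<in>A - {p k}. g (p k) l)"
    by simp
  also have "\<dots> = (\<Sum>j\<in>A. \<Sum>l\<in>A - {j}. g j l)"
    using sum.reindex_bij_betw[OF b, of "\<lambda>j. \<Sum>l\<in>A - {j}. g j l"] .
  finally show ?thesis .
qed

text \<open>The argument for one point, with ordered pairs of distinct positions and double
  transitivity in place of a single transposition.\<close>

lemma pavg_marginal2:
  assumes "finite A" "i \<in> A" "i' \<in> A" "i \<noteq> i'"
  shows "pavg A (\<lambda>p. g (p i) (p i')) = (\<Sum>j\<in>A. \<Sum>l\<in>A - {j}. g j l) / (card A * (real (card A) - 1))"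
proof -
  have c: "card A \<ge> 2" using assms card_mono[of A "{i,i'}"] by simp
  have eq: "pavg A (\<lambda>p. g (p k) (p l)) = pavg A (\<lambda>p. g (p i) (p i'))"
    if kl: "k \<in> A" "l \<in> A - {k}" for k l
  proof -
    obtain q where "q permutes A" "q i = k" "q i' = l"
      using exists_permutes_pair[OF assms(2-4), of k l] kl by blast
    with pavg_compose_right[of q A "\<lambda>p. g (p i) (p i')"] show ?thesis by simp
  qed
  have "(card A * (real (card A) - 1)) * pavg A (\<lambda>p. g (p i) (p i'))
     = (\<Sum>k\<in>A. \<Sum>l\<in>A - {k}. pavg A (\<lambda>p. g (p k) (p l)))"
  proof -
    have "(\<Sum>k\<in>A. \<Sum>l\<in>A - {k}. pavg A (\<lambda>p. g (p k) (p l)))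
       = (\<Sum>k\<in>A. \<Sum>l\<in>A - {k}. pavg A (\<lambda>p. g (p i) (p i')))"
      by (intro sum.cong refl eq)
    thus ?thesis using c by (simp add: of_nat_diff)
  qed
  also have "\<dots> = pavg A (\<lambda>p. \<Sum>k\<in>A. \<Sum>l\<in>A - {k}. g (p k) (p l))" by (simp add: pavg_sum)
  also have "\<dots> = pavg A (\<lambda>p. \<Sum>j\<in>A. \<Sum>l\<in>A - {j}. g j l)"
    by (rule pavg_cong) (rule sum_offdiag_permute)
  finally have "(card A * (real (card A) - 1)) * pavg A (\<lambda>p. g (p i) (p i'))
     = (\<Sum>j\<in>A. \<Sum>l\<in>A - {j}. g j l)"
    using assms by (simp add: pavg_const)
  moreover have "card A * (real (card A) - 1) \<noteq> 0" using c by simp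
  ultimately show ?thesis
    using nonzero_eq_divide_eq[of "card A * (real (card A) - 1)" "pavg A (\<lambda>p. g (p i) (p i'))"
        "\<Sum>j\<in>A. \<Sum>l\<in>A - {j}. g j l"]
    unfolding mult.commute[of "pavg A _"] by blast
qed

section \<open>First and second moments of linear functions of a random permutation\<close>

lemma sum_offdiag_centred:
  fixes c d :: "'a \<Rightarrow> real"
  assumes "finite A" "sum d A = 0"
  shows "(\<Sum>j\<in>A. \<Sum>l\<in>A - {j}. c j * d l) = - (\<Sum>j\<in>A. c j * d j)"
proof -
  have "(\<Sum>l\<in>A - {j}. c j * d l) = - (c j * d j)" if "j \<in> A" for j
    using assms that by (simp add: sum_distrib_left[symmetric] sum_diff1)
  thus ?thesis by (simp add: sum_negf)
qed

text \<open>Sampling without replacement from centred values: distinct draws are nonpositively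
  correlated, so only the diagonal terms count in an upper bound.\<close>

lemma pavg_square_partial_sum_le:
  fixes c :: "'a \<Rightarrow> real"
  assumes "finite N" "A \<subseteq> N" "sum c N = 0"
  shows "pavg N (\<lambda>p. (\<Sum>k\<in>A. c (p k))\<^sup>2) \<le> card A / card N * (\<Sum>j\<in>N. (c j)\<^sup>2)"
proof -
  let ?S = "\<Sum>j\<in>N. (c j)\<^sup>2"
  have fA: "finite A" using assms finite_subset by blast
  have diag: "pavg N (\<lambda>p. c (p k) * c (p k)) = ?S / card N" if "k \<in> A" for k
    using pavg_marginal[of N k "\<lambda>x. c x * c x"] assms that by (auto simp: power2_eq_square)
  have off: "pavg N (\<lambda>p. c (p k) * c (p l)) \<le> 0" if "k \<in> A" "l \<in> A - {k}" for k l
  proof -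
    have "pavg N (\<lambda>p. c (p k) * c (p l)) = (- (\<Sum>j\<in>N. c j * c j)) / (card N * (real (card N) - 1))"
    proof -
      have "k \<in> N" "l \<in> N" "k \<noteq> l" using that assms(2) by auto
      from pavg_marginal2[OF assms(1) this, of "\<lambda>x y. c x * c y"] show ?thesis
        by (simp only: sum_offdiag_centred[OF assms(1,3)])
    qed
    also have "\<dots> \<le> 0"
    proof -
      have "card N > 0" using that assms(1,2) by (auto simp: card_gt_0_iff)
      moreover have "0 \<le> (\<Sum>j\<in>N. c j * c j)" by (intro sum_nonneg) simp
      ultimately show ?thesis by (intro divide_nonpos_nonneg) simp_all
    qed
    finally show ?thesis .
  qed
  have "pavg N (\<lambda>p. (\<Sum>k\<in>A. c (p k))\<^sup>2) = (\<Sum>k\<in>A. \<Sum>l\<in>A. pavg N (\<lambda>p. c (p k) * c (p l)))"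
    by (simp add: power2_eq_square sum_product pavg_sum)
  also have "\<dots> = (\<Sum>k\<in>A. ?S / card N + (\<Sum>l\<in>A - {k}. pavg N (\<lambda>p. c (p k) * c (p l))))"
  proof (intro sum.cong refl)
    fix k assume "k \<in> A"
    thus "(\<Sum>l\<in>A. pavg N (\<lambda>p. c (p k) * c (p l)))
       = ?S / card N + (\<Sum>l\<in>A - {k}. pavg N (\<lambda>p. c (p k) * c (p l)))"
      using sum.remove[OF fA, of k "\<lambda>l. pavg N (\<lambda>p. c (p k) * c (p l))"] diag[of k] by simp
  qed
  also have "\<dots> \<le> (\<Sum>k\<in>A. ?S / card N + 0)"
    by (intro sum_mono add_left_mono sum_nonpos off)
  finally show ?thesis by simp
qed

lemma sum_of_bool_single:
  fixes g :: "'a \<Rightarrow> real"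
  assumes "finite A" "j \<in> A"
  shows "(\<Sum>x\<in>A. of_bool (x = j) * g x) = g j" "(\<Sum>x\<in>A. of_bool (j = x) * g x) = g j"
proof -
  have "(\<Sum>x\<in>A. of_bool (x = j) * g x) = (\<Sum>x\<in>A. if x = j then g x else 0)"
    by (intro sum.cong) auto
  thus "(\<Sum>x\<in>A. of_bool (x = j) * g x) = g j" using assms by simp
  thus "(\<Sum>x\<in>A. of_bool (j = x) * g x) = g j" by (simp only: eq_commute[of j])
qed

text \<open>Position \<open>i\<close> contributes \<open>b i j / n\<close>. Every other
  \<open>k\<close> contributes \<open>- b k j / (n * (n - 1))\<close>, because row \<open>k\<close>
  loses its entry in column \<open>j\<close>; the zero column sum turns these into a second multiple
  of \<open>b i j\<close>. Thus correlations with 1-cosets recover the coefficients.\<close>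

lemma pavg_indicator_linear:
  fixes b :: "'a \<Rightarrow> 'a \<Rightarrow> real"
  assumes fin: "finite A" and n2: "card A \<ge> 2" and ij: "i \<in> A" "j \<in> A"
    and row: "\<And>i. i \<in> A \<Longrightarrow> (\<Sum>j\<in>A. b i j) = 0"
    and col: "\<And>j. j \<in> A \<Longrightarrow> (\<Sum>i\<in>A. b i j) = 0"
  shows "pavg A (\<lambda>p. of_bool (p i = j) * (\<Sum>k\<in>A. b k (p k))) = b i j / (real (card A) - 1)"
proof -
  let ?n = "real (card A)"
  have diag: "pavg A (\<lambda>p. of_bool (p i = j) * b i (p i)) = b i j / ?n"
    by (simp only: pavg_marginal[OF fin ij(1), of "\<lambda>x. of_bool (x = j) * b i x"]
      sum_of_bool_single[OF fin ij(2)])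
  have off: "pavg A (\<lambda>p. of_bool (p i = j) * b k (p k)) = - b k j / (?n * (?n - 1))"
    if k: "k \<in> A - {i}" for k
  proof -
    have "(\<Sum>x\<in>A. \<Sum>y\<in>A - {x}. of_bool (x = j) * b k y) = - b k j"
      using sum_offdiag_centred[OF fin row, of k "\<lambda>x. of_bool (x = j)"] k
        sum_of_bool_single(1)[OF fin ij(2), of "b k"] by simp
    thus ?thesis
      using pavg_marginal2[of A i k "\<lambda>x y. of_bool (x = j) * b k y"] fin ij k by auto
  qed
  have "pavg A (\<lambda>p. of_bool (p i = j) * (\<Sum>k\<in>A. b k (p k)))
     = (\<Sum>k\<in>A. pavg A (\<lambda>p. of_bool (p i = j) * b k (p k)))"
    by (simp add: sum_distrib_left pavg_sum)
  also have "\<dots> = b i j / ?n + (\<Sum>k\<in>A - {i}. - b k j / (?n * (?n - 1)))"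
    unfolding sum.remove[OF fin ij(1), of "\<lambda>k. pavg A (\<lambda>p. of_bool (p i = j) * b k (p k))"] diag
    using sum.cong[OF refl off, of "A - {i}"] by simp
  also have "(\<Sum>k\<in>A - {i}. - b k j / (?n * (?n - 1))) = b i j / (?n * (?n - 1))"
  proof -
    have "(\<Sum>k\<in>A - {i}. b k j) = - b i j"
      using col[OF ij(2)] sum.remove[OF fin ij(1), of "\<lambda>k. b k j"] by simp
    thus ?thesis unfolding sum_divide_distrib[symmetric] sum_negf by simp
  qed
  also have "b i j / ?n + b i j / (?n * (?n - 1)) = b i j / (?n - 1)"
  proof -
    have "?n \<noteq> 0" "?n - 1 \<noteq> 0" using n2 by auto
    thus ?thesis by (simp add: divide_simps) (simp add: algebra_simps)
  qed
  finally show ?thesis .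
qed

lemma pavg_linear_centred:
  fixes b :: "'a \<Rightarrow> 'a \<Rightarrow> real"
  assumes "finite A" and "\<And>i. i \<in> A \<Longrightarrow> (\<Sum>j\<in>A. b i j) = 0"
  shows "pavg A (\<lambda>p. \<Sum>k\<in>A. b k (p k)) = 0"
  unfolding pavg_sum using pavg_marginal[OF assms(1), of _ "b _"] assms(2)
  by (intro sum.neutral) simp

text \<open>One factor of the square is expanded into indicators of \<open>p i = j\<close>; each
  then pairs with the other factor by \<open>pavg_indicator_linear\<close>.\<close>

lemma pavg_linear_square:
  fixes b :: "'a \<Rightarrow> 'a \<Rightarrow> real"
  assumes fin: "finite A" and n2: "card A \<ge> 2"
    and row: "\<And>i. i \<in> A \<Longrightarrow> (\<Sum>j\<in>A. b i j) = 0"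
    and col: "\<And>j. j \<in> A \<Longrightarrow> (\<Sum>i\<in>A. b i j) = 0"
  shows "pavg A (\<lambda>p. (\<Sum>k\<in>A. b k (p k))\<^sup>2) = (\<Sum>i\<in>A. \<Sum>j\<in>A. (b i j)\<^sup>2) / (real (card A) - 1)"
proof -
  have "pavg A (\<lambda>p. (\<Sum>k\<in>A. b k (p k))\<^sup>2)
     = pavg A (\<lambda>p. \<Sum>i\<in>A. \<Sum>j\<in>A. b i j * (of_bool (p i = j) * (\<Sum>k\<in>A. b k (p k))))"
  proof (rule pavg_cong)
    fix p assume p: "p permutes A"
    have "(\<Sum>j\<in>A. b i j * (of_bool (p i = j) * S)) = b i (p i) * S" if "i \<in> A" for i S
    proof -
      have "p i \<in> A" using permutes_in_image[OF p] that by simp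
      from sum_of_bool_single(2)[OF fin this, of "\<lambda>j. b i j * S"] show ?thesis
        by (simp add: mult.left_commute)
    qed
    thus "(\<Sum>k\<in>A. b k (p k))\<^sup>2 = (\<Sum>i\<in>A. \<Sum>j\<in>A. b i j * (of_bool (p i = j) * (\<Sum>k\<in>A. b k (p k))))"
      by (simp add: power2_eq_square sum_distrib_right)
  qed
  also have "\<dots> = (\<Sum>i\<in>A. \<Sum>j\<in>A. b i j * (b i j / (real (card A) - 1)))"
    unfolding pavg_sum pavg_cmult
    by (intro sum.cong refl arg_cong2[where f="(*)"] pavg_indicator_linear[OF fin n2 _ _ row col])
  finally show ?thesis by (simp add: power2_eq_square sum_divide_distrib)
qed

section \<open>Signs approximated by a sum of separated variables\<close>

text \<open>If a sign pattern changes between \<open>a, a'\<close> (first variable) and between \<open>b'', c''\<close> (second variable),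
  one of the three intermediate second differences is nonzero. This is the only place where the
  values being \<open>\<plusminus>1\<close> enters.\<close>

lemma four_point_signs:
  fixes a a' b b' b'' c c' c'' :: real
  assumes "a \<in> {-1, 1}" "a' \<in> {-1, 1}" "b \<in> {-1, 1}" "b' \<in> {-1, 1}" "b'' \<in> {-1, 1}"
    "c \<in> {-1, 1}" "c' \<in> {-1, 1}" "c'' \<in> {-1, 1}"
  shows "(a - a')\<^sup>2 * (b'' - c'')\<^sup>2 \<le>
    4 * ((a - a' - b + b')\<^sup>2 + (b - b'' - c + c'')\<^sup>2 + (b' - b'' - c' + c'')\<^sup>2)"
proof (cases "a = a' \<or> b'' = c''")
  case True
  thus ?thesis by auto
next
  case False
  hence "a' = - a" "c'' = - b''" using assms by auto
  thus ?thesis using assms by (elim insertE emptyE) (simp_all add: power2_eq_square)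
qed

lemma square_four_le:
  fixes a b c d :: real
  shows "(a - b - c + d)\<^sup>2 \<le> 4 * (a\<^sup>2 + b\<^sup>2 + c\<^sup>2 + d\<^sup>2)"
proof -
  have "4 * (a\<^sup>2 + b\<^sup>2 + c\<^sup>2 + d\<^sup>2) - (a - b - c + d)\<^sup>2
     = (a + b)\<^sup>2 + (a + c)\<^sup>2 + (a - d)\<^sup>2 + (b - c)\<^sup>2 + (b + d)\<^sup>2 + (c + d)\<^sup>2"
    by (simp add: power2_eq_square algebra_simps)
  also have "\<dots> \<ge> 0" by simp
  finally show ?thesis by simp
qed

lemma square_three_le:
  fixes a b c :: real
  shows "(a - b + c)\<^sup>2 \<le> 2 * a\<^sup>2 + 4 * b\<^sup>2 + 4 * c\<^sup>2"
proof -
  have "2 * a\<^sup>2 + 4 * b\<^sup>2 + 4 * c\<^sup>2 - (a - b + c)\<^sup>2 = (a + b - c)\<^sup>2 + 2 * (b + c)\<^sup>2"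
    by (simp add: power2_eq_square algebra_simps)
  also have "\<dots> \<ge> 0" by simp
  finally show ?thesis by simp
qed

text \<open>In \<open>u x - u x'\<close> the term \<open>v y\<close> cancels: it is
  \<open>f x y - f x' y\<close> minus the approximation error at \<open>(x, y)\<close> plus that at
  \<open>(x', y)\<close>. The free \<open>y\<close> is averaged out, and the two errors contribute 4
  + 4 = 8.\<close>

lemma pavg_diff_square_le:
  fixes f :: "('a \<Rightarrow> 'a) \<Rightarrow> ('b \<Rightarrow> 'b) \<Rightarrow> real"
  assumes A: "finite A" and B: "finite B"
  shows "pavg A (\<lambda>x. pavg A (\<lambda>x'. (u x - u x')\<^sup>2)) \<le>
     2 * pavg A (\<lambda>x. pavg A (\<lambda>x'. pavg B (\<lambda>y. (f x y - f x' y)\<^sup>2)))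
     + 8 * pavg A (\<lambda>x. pavg B (\<lambda>y. (f x y - u x - v y)\<^sup>2))"
proof -
  let ?h = "\<lambda>x y. f x y - u x - v y"
  have "(u x - u x')\<^sup>2 \<le> pavg B (\<lambda>y. 2 * (f x y - f x' y)\<^sup>2 + 4 * (?h x y)\<^sup>2 + 4 * (?h x' y)\<^sup>2)" for x x'
  proof -
    have "(u x - u x')\<^sup>2 = pavg B (\<lambda>y. (u x - u x')\<^sup>2)" using B by (simp add: pavg_const)
    also have "\<dots> \<le> pavg B (\<lambda>y. 2 * (f x y - f x' y)\<^sup>2 + 4 * (?h x y)\<^sup>2 + 4 * (?h x' y)\<^sup>2)"
    proof (rule pavg_mono)
      fix y
      show "(u x - u x')\<^sup>2 \<le> 2 * (f x y - f x' y)\<^sup>2 + 4 * (?h x y)\<^sup>2 + 4 * (?h x' y)\<^sup>2"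
        using square_three_le[of "f x y - f x' y" "?h x y" "?h x' y"] by simp
    qed
    finally show ?thesis .
  qed
  hence "pavg A (\<lambda>x. pavg A (\<lambda>x'. (u x - u x')\<^sup>2)) \<le> pavg A (\<lambda>x. pavg A (\<lambda>x'.
     pavg B (\<lambda>y. 2 * (f x y - f x' y)\<^sup>2 + 4 * (?h x y)\<^sup>2 + 4 * (?h x' y)\<^sup>2)))"
    by (intro pavg_mono)
  also have "\<dots> = 2 * pavg A (\<lambda>x. pavg A (\<lambda>x'. pavg B (\<lambda>y. (f x y - f x' y)\<^sup>2)))
     + 8 * pavg A (\<lambda>x. pavg B (\<lambda>y. (?h x y)\<^sup>2))"
    by (simp add: pavg_add pavg_cmult pavg_const[OF A])
  finally show ?thesis .
qed

text \<open>The product of the two means is one mean over six independent variables, to which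
  \<open>four_point_signs\<close> applies pointwise. Each second difference of \<open>f\<close> is
  then a signed sum of four approximation errors.\<close>

lemma pavg_sensitivity_product_le:
  fixes f :: "('a \<Rightarrow> 'a) \<Rightarrow> ('b \<Rightarrow> 'b) \<Rightarrow> real"
  assumes A: "finite A" and B: "finite B"
    and sgn: "\<And>x y. x permutes A \<Longrightarrow> y permutes B \<Longrightarrow> f x y \<in> {-1, 1}"
  shows "pavg A (\<lambda>x. pavg A (\<lambda>x'. pavg B (\<lambda>y. (f x y - f x' y)\<^sup>2))) *
         pavg A (\<lambda>x. pavg B (\<lambda>y. pavg B (\<lambda>y'. (f x y - f x y')\<^sup>2)))
     \<le> 192 * pavg A (\<lambda>x. pavg B (\<lambda>y. (f x y - u x - v y)\<^sup>2))" (is "?\<alpha> * ?\<gamma> \<le> 192 * ?e")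
proof -
  let ?D = "\<lambda>x x' y y'. (f x y - f x' y - f x y' + f x' y')\<^sup>2"
  let ?h = "\<lambda>x y. f x y - u x - v y"
  have "?\<alpha> * ?\<gamma> = pavg A (\<lambda>x. pavg A (\<lambda>x'. pavg A (\<lambda>x''. pavg B (\<lambda>y. pavg B (\<lambda>y''. pavg B (\<lambda>z.
      (f x y - f x' y)\<^sup>2 * (f x'' y'' - f x'' z)\<^sup>2))))))"
    by (simp only: pavg_cmult pavg_cmult_right)
  also have "\<dots> \<le> pavg A (\<lambda>x. pavg A (\<lambda>x'. pavg A (\<lambda>x''. pavg B (\<lambda>y. pavg B (\<lambda>y''. pavg B (\<lambda>z.
      4 * (?D x x' y y'' + ?D x x'' y'' z + ?D x' x'' y'' z)))))))"
    by (intro pavg_mono four_point_signs sgn)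
  \<comment> \<open>All three second differences have the same mean after the idle variables are
    dropped, hence 4 * 3. Bounding each by 16 times the error below gives 12 * 16 = 192.\<close>
  also have "\<dots> = 12 * pavg A (\<lambda>x. pavg A (\<lambda>x'. pavg B (\<lambda>y. pavg B (\<lambda>y'. ?D x x' y y'))))"
    by (simp only: pavg_add pavg_cmult pavg_const[OF A] pavg_const[OF B]) simp
  also have "pavg A (\<lambda>x. pavg A (\<lambda>x'. pavg B (\<lambda>y. pavg B (\<lambda>y'. ?D x x' y y')))) \<le>
     pavg A (\<lambda>x. pavg A (\<lambda>x'. pavg B (\<lambda>y. pavg B (\<lambda>y'.
       4 * ((?h x y)\<^sup>2 + (?h x' y)\<^sup>2 + (?h x y')\<^sup>2 + (?h x' y')\<^sup>2)))))"
  proof (intro pavg_mono)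
    fix x x' y y'
    show "?D x x' y y' \<le> 4 * ((?h x y)\<^sup>2 + (?h x' y)\<^sup>2 + (?h x y')\<^sup>2 + (?h x' y')\<^sup>2)"
      using square_four_le[of "?h x y" "?h x' y" "?h x y'" "?h x' y'"] by (simp add: algebra_simps)
  qed
  also have "\<dots> = 16 * ?e"
    by (simp only: pavg_add pavg_cmult pavg_const[OF A] pavg_const[OF B]) simp
  finally show ?thesis by simp
qed

text \<open>Second differences of \<open>u x + v y\<close> vanish, so those of \<open>f\<close> are controlled by the approximation error.
  The a priori bound 30 is only needed when the error exceeds 1.\<close>

lemma pavg_variance_product_le:
  fixes f :: "('a \<Rightarrow> 'a) \<Rightarrow> ('b \<Rightarrow> 'b) \<Rightarrow> real"
  assumes A: "finite A" and B: "finite B"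
    and sgn: "\<And>x y. x permutes A \<Longrightarrow> y permutes B \<Longrightarrow> f x y \<in> {-1, 1}"
    and U: "pavg A (\<lambda>x. pavg A (\<lambda>x'. (u x - u x')\<^sup>2)) \<le> 30" (is "?U \<le> _")
    and V: "pavg B (\<lambda>y. pavg B (\<lambda>y'. (v y - v y')\<^sup>2)) \<le> 30" (is "?V \<le> _")
  shows "?U * ?V \<le> 960 * pavg A (\<lambda>x. pavg B (\<lambda>y. (f x y - u x - v y)\<^sup>2))" (is "_ \<le> 960 * ?e")
proof -
  let ?a = "pavg A (\<lambda>x. pavg A (\<lambda>x'. pavg B (\<lambda>y. (f x y - f x' y)\<^sup>2)))"
  let ?c = "pavg A (\<lambda>x. pavg B (\<lambda>y. pavg B (\<lambda>y'. (f x y - f x y')\<^sup>2)))"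
  have Ua: "?U \<le> 2 * ?a + 8 * ?e" by (rule pavg_diff_square_le[OF A B])
  have "?c = pavg B (\<lambda>y. pavg B (\<lambda>y'. pavg A (\<lambda>x. (f x y - f x y')\<^sup>2)))"
    by (subst pavg_commute) (simp add: pavg_commute[of A])
  moreover have "?e = pavg B (\<lambda>y. pavg A (\<lambda>x. (f x y - v y - u x)\<^sup>2))"
    by (subst pavg_commute) (simp add: algebra_simps)
  ultimately have Vc: "?V \<le> 2 * ?c + 8 * ?e"
    using pavg_diff_square_le[OF B A, of v "\<lambda>y x. f x y" u] by simp
  have ac: "?a * ?c \<le> 192 * ?e" by (rule pavg_sensitivity_product_le[OF A B sgn])
  have four: "(s - t)\<^sup>2 \<le> 4" if "s \<in> {-1, 1}" "t \<in> {-1, 1}" for s t :: real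
    using that by auto
  have "?a \<le> pavg A (\<lambda>x. pavg A (\<lambda>x'. pavg B (\<lambda>y. 4)))" by (intro pavg_mono four sgn)
  hence a4: "?a \<le> 4" using A B by (simp add: pavg_const)
  have "?c \<le> pavg A (\<lambda>x. pavg B (\<lambda>y. pavg B (\<lambda>y'. 4)))" by (intro pavg_mono four sgn)
  hence c4: "?c \<le> 4" using A B by (simp add: pavg_const)
  have e0: "0 \<le> ?e" and a0: "0 \<le> ?a" and c0: "0 \<le> ?c" and U0: "0 \<le> ?U" and V0: "0 \<le> ?V"
    by (intro pavg_nonneg zero_le_power2)+
  show ?thesis
  proof (cases "?e \<le> 1")
    case True
    have "?U * ?V \<le> (2 * ?a + 8 * ?e) * (2 * ?c + 8 * ?e)"
      using Ua Vc U0 V0 a0 e0 by (intro mult_mono) auto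
    also have "\<dots> = 4 * (?a * ?c) + 16 * (?a * ?e) + 16 * (?c * ?e) + 64 * (?e * ?e)"
      by (simp add: algebra_simps)
    \<comment> \<open>The bound \<open>?e \<le> 1\<close> makes the quadratic term linear, and 768 +
      64 + 64 + 64 = 960. In the other case 30 * 30 stays below the same constant.\<close>
    also have "\<dots> \<le> 4 * (192 * ?e) + 16 * (4 * ?e) + 16 * (4 * ?e) + 64 * (1 * ?e)"
      using ac a4 c4 True e0 by (intro add_mono mult_left_mono mult_right_mono) auto
    finally show ?thesis by simp
  next
    case False
    have "?U * ?V \<le> 30 * 30" using U V U0 V0 by (intro mult_mono) auto
    thus ?thesis using False by simp
  qed
qed

section \<open>Matrices with little nonconflicting mass\<close>

lemma sum_minus_row_col:
  fixes w :: "'a \<Rightarrow> 'a \<Rightarrow> real"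
  assumes "finite N" "i \<in> N" "j \<in> N"
  shows "(\<Sum>k\<in>N - {i}. \<Sum>l\<in>N - {j}. w k l)
    = (\<Sum>k\<in>N. \<Sum>l\<in>N. w k l) - (\<Sum>l\<in>N. w i l) - (\<Sum>k\<in>N. w k j) + w i j"
  using assms by (simp add: sum_diff1 sum_subtractf)

text \<open>An entry in column \<open>j\<close> outside row \<open>i0\<close> conflicts with only
  one entry of that row, the one in column \<open>j\<close>, so it is paired with mass at least the
  row sum minus \<open>m\<close>.\<close>

lemma heavy_row_dominates:
  fixes w :: "'a \<Rightarrow> 'a \<Rightarrow> real"
  assumes fin: "finite N" and w0: "\<And>i j. 0 \<le> w i j" and i0: "i0 \<in> N"
    and m: "\<And>j. j \<in> N \<Longrightarrow> w i0 j \<le> m"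
  shows "((\<Sum>i\<in>N. \<Sum>j\<in>N. w i j) - (\<Sum>j\<in>N. w i0 j)) * ((\<Sum>j\<in>N. w i0 j) - m)
     \<le> (\<Sum>i\<in>N. \<Sum>j\<in>N. w i j * (\<Sum>k\<in>N - {i}. \<Sum>l\<in>N - {j}. w k l))"
proof -
  let ?R = "\<Sum>j\<in>N. w i0 j"
  have "((\<Sum>i\<in>N. \<Sum>j\<in>N. w i j) - ?R) * (?R - m) = (\<Sum>i\<in>N - {i0}. \<Sum>j\<in>N. w i j * (?R - m))"
    unfolding sum_distrib_right[symmetric] using fin i0 by (simp add: sum_diff1)
  also have "\<dots> \<le> (\<Sum>i\<in>N - {i0}. \<Sum>j\<in>N. w i j * (\<Sum>k\<in>N - {i}. \<Sum>l\<in>N - {j}. w k l))"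
  proof (intro sum_mono mult_left_mono w0)
    fix i j assume ij: "i \<in> N - {i0}" "j \<in> N"
    have "?R - m \<le> (\<Sum>l\<in>N - {j}. w i0 l)" using m[OF ij(2)] fin ij by (simp add: sum_diff1)
    also have "\<dots> \<le> (\<Sum>k\<in>N - {i}. \<Sum>l\<in>N - {j}. w k l)"
      using fin i0 ij by (intro member_le_sum sum_nonneg w0) auto
    finally show "?R - m \<le> (\<Sum>k\<in>N - {i}. \<Sum>l\<in>N - {j}. w k l)" .
  qed
  also have "\<dots> \<le> (\<Sum>i\<in>N. \<Sum>j\<in>N. w i j * (\<Sum>k\<in>N - {i}. \<Sum>l\<in>N - {j}. w k l))"
    using fin by (intro sum_mono2 sum_nonneg mult_nonneg_nonneg w0) auto
  finally show ?thesis .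
qed

text \<open>The threshold 3/8 serves both cases. A row or column sum \<open>R\<close> above it has
  \<open>R - m \<ge> W / 4\<close>, as \<open>m \<le> W / 8\<close>. If no line exceeds it, deleting
  one row and one column leaves at least \<open>W / 4\<close>, so the nonconflicting mass reaches
  \<open>W * W / 4\<close> and contradicts \<open>dW\<close>.\<close>

lemma dominant_line:
  fixes w :: "'a \<Rightarrow> 'a \<Rightarrow> real"
  assumes fin: "finite N" and w0: "\<And>i j. 0 \<le> w i j"
    and m: "\<And>i j. i \<in> N \<Longrightarrow> j \<in> N \<Longrightarrow> w i j \<le> m"
    and W: "W = (\<Sum>i\<in>N. \<Sum>j\<in>N. w i j)" and Wpos: "0 < W" and mW: "8 * m \<le> W"
    and d: "(\<Sum>i\<in>N. \<Sum>j\<in>N. w i j * (\<Sum>k\<in>N - {i}. \<Sum>l\<in>N - {j}. w k l)) \<le> \<delta>" (is "?NC \<le> _")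
    and dW: "4 * \<delta> < W\<^sup>2"
  shows "(\<exists>i\<in>N. W - (\<Sum>j\<in>N. w i j) \<le> 4 * \<delta> / W) \<or> (\<exists>j\<in>N. W - (\<Sum>i\<in>N. w i j) \<le> 4 * \<delta> / W)"
proof -
  have heavy: "W - R \<le> 4 * \<delta> / W" if "3 / 8 * W < R" "(W - R) * (R - m) \<le> \<delta>" "R \<le> W" for R
  proof -
    have "(W - R) * (W / 4) \<le> (W - R) * (R - m)" using that mW by (intro mult_left_mono) auto
    thus ?thesis using that Wpos by (simp add: field_simps)
  qed
  have swapW: "W = (\<Sum>j\<in>N. \<Sum>i\<in>N. w i j)" unfolding W by (rule sum.swap)
  show ?thesis
  proof (cases "\<exists>i\<in>N. 3 / 8 * W < (\<Sum>j\<in>N. w i j)")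
    case True
    then obtain i where i: "i \<in> N" "3 / 8 * W < (\<Sum>j\<in>N. w i j)" by blast
    have "(\<Sum>j\<in>N. w i j) \<le> W" unfolding W using fin i
      by (intro member_le_sum[of i N "\<lambda>i. \<Sum>j\<in>N. w i j"] sum_nonneg w0) auto
    with heavy[OF i(2)] heavy_row_dominates[of N w i m] fin w0 i m d W show ?thesis by force
  next
    case noR: False
    show ?thesis
    proof (cases "\<exists>j\<in>N. 3 / 8 * W < (\<Sum>i\<in>N. w i j)")
      case True
      then obtain j where j: "j \<in> N" "3 / 8 * W < (\<Sum>i\<in>N. w i j)" by blast
      have "?NC = (\<Sum>j\<in>N. \<Sum>i\<in>N. w i j * (\<Sum>l\<in>N - {j}. \<Sum>k\<in>N - {i}. w k l))"
        by (subst sum.swap) (intro sum.cong refl arg_cong2[where f="(*)"] sum.swap)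
      hence "(W - (\<Sum>i\<in>N. w i j)) * ((\<Sum>i\<in>N. w i j) - m) \<le> \<delta>"
        using heavy_row_dominates[of N "\<lambda>j i. w i j" j m] fin w0 j m d swapW by simp
      moreover have "(\<Sum>i\<in>N. w i j) \<le> W" unfolding swapW using fin j
        by (intro member_le_sum[of j N "\<lambda>j. \<Sum>i\<in>N. w i j"] sum_nonneg w0) auto
      ultimately show ?thesis using heavy[OF j(2)] j by blast
    next
      case noC: False
      have "W * (W / 4) = (\<Sum>i\<in>N. \<Sum>j\<in>N. w i j * (W / 4))"
        by (simp only: W sum_distrib_right)
      also have "\<dots> \<le> ?NC"
      proof (intro sum_mono mult_left_mono w0)
        fix i j assume ij: "i \<in> N" "j \<in> N"
        thus "W / 4 \<le> (\<Sum>k\<in>N - {i}. \<Sum>l\<in>N - {j}. w k l)"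
          unfolding sum_minus_row_col[OF fin ij] W[symmetric] using noR noC w0[of i j]
          by (force simp: not_less)
      qed
      finally have eq: "W * W / 4 \<le> ?NC" by simp
      with d dW show ?thesis by (simp add: power2_eq_square)
    qed
  qed
qed

section \<open>Random block decompositions\<close>

text \<open>Normalised so as to match, within constant factors and up to \<open>block_bias\<close>,
  the variance of \<open>\<Sum>i\<in>A. b i (p i)\<close> over permutations of
  \<open>A\<close>.\<close>

definition block_mass :: "('a \<Rightarrow> 'a \<Rightarrow> real) \<Rightarrow> 'a set \<Rightarrow> real" where
  "block_mass b A = (\<Sum>i\<in>A. \<Sum>k\<in>A. (b i k)\<^sup>2) / card A"

text \<open>An upper bound for what double centring removes from \<open>block_mass\<close>; a block
  of a doubly centred matrix need not be centred itself.\<close>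

definition block_bias :: "('a \<Rightarrow> 'a \<Rightarrow> real) \<Rightarrow> 'a set \<Rightarrow> real" where
  "block_bias b A =
     ((\<Sum>i\<in>A. (\<Sum>k\<in>A. b i k)\<^sup>2) + (\<Sum>k\<in>A. (\<Sum>i\<in>A. b i k)\<^sup>2)) / (real (card A))\<^sup>2"

text \<open>Row means and column means are subtracted and the overall mean is added back. Along a
  permutation these corrections sum to a constant. The centred matrix \<open>d\<close> is orthogonal
  to them, so the sum of its squares equals its inner product with \<open>b\<close>, which yields
  both inequalities.\<close>

lemma double_centring:
  fixes b :: "'a \<Rightarrow> 'a \<Rightarrow> real"
  assumes fin: "finite A" and ne: "A \<noteq> {}"
  obtains d c where
    "\<forall>i\<in>A. (\<Sum>j\<in>A. d i j) = 0" "\<forall>j\<in>A. (\<Sum>i\<in>A. d i j) = 0"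
    "\<forall>p. p permutes A \<longrightarrow> (\<Sum>i\<in>A. b i (p i)) = c + (\<Sum>i\<in>A. d i (p i))"
    "(\<Sum>i\<in>A. \<Sum>j\<in>A. (d i j)\<^sup>2) \<le> (\<Sum>i\<in>A. \<Sum>j\<in>A. (b i j)\<^sup>2)"
    "card A * (block_mass b A - block_bias b A) \<le> (\<Sum>i\<in>A. \<Sum>j\<in>A. (d i j)\<^sup>2)"
proof -
  define h where "h = real (card A)"
  have h: "h > 0" using fin ne by (simp add: h_def card_gt_0_iff)
  define r where "r i = (\<Sum>j\<in>A. b i j) / h" for i
  define s where "s j = (\<Sum>i\<in>A. b i j) / h" for j
  define t where "t = (\<Sum>i\<in>A. \<Sum>j\<in>A. b i j) / h\<^sup>2"
  define d where "d i j = b i j - r i - s j + t" for i j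
  have rs: "(\<Sum>j\<in>A. b i j) = h * r i" "(\<Sum>i\<in>A. b i j) = h * s j" for i j
    using h by (auto simp: r_def s_def)
  have sr: "sum r A = h * t"
    using h by (simp add: r_def t_def sum_divide_distrib[symmetric] power2_eq_square)
  have ss: "sum s A = h * t"
    using h by (simp add: s_def t_def sum_divide_distrib[symmetric] power2_eq_square sum.swap[of b])
  have row: "(\<Sum>j\<in>A. d i j) = 0" for i
    by (simp add: d_def sum.distrib sum_subtractf rs ss h_def[symmetric])
  have col: "(\<Sum>i\<in>A. d i j) = 0" for j
    by (simp add: d_def sum.distrib sum_subtractf rs sr h_def[symmetric])
  have perm: "(\<Sum>i\<in>A. b i (p i)) = h * t + (\<Sum>i\<in>A. d i (p i))" if "p permutes A" for p
  proof -
    have "(\<Sum>i\<in>A. s (p i)) = sum s A"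
      using sum.reindex_bij_betw[OF permutes_imp_bij[OF that], of s] .
    thus ?thesis by (simp add: d_def sum.distrib sum_subtractf sr ss h_def[symmetric])
  qed
  have sd: "(\<Sum>i\<in>A. \<Sum>j\<in>A. d i j * r i) = 0" "(\<Sum>i\<in>A. \<Sum>j\<in>A. d i j * s j) = 0"
    "(\<Sum>i\<in>A. \<Sum>j\<in>A. d i j * t) = 0"
  proof -
    show "(\<Sum>i\<in>A. \<Sum>j\<in>A. d i j * r i) = 0" "(\<Sum>i\<in>A. \<Sum>j\<in>A. d i j * t) = 0"
      by (simp_all add: sum_distrib_right[symmetric] row)
    have "(\<Sum>i\<in>A. \<Sum>j\<in>A. d i j * s j) = (\<Sum>j\<in>A. \<Sum>i\<in>A. d i j * s j)" by (rule sum.swap)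
    thus "(\<Sum>i\<in>A. \<Sum>j\<in>A. d i j * s j) = 0" by (simp add: sum_distrib_right[symmetric] col)
  qed
  have "(\<Sum>i\<in>A. \<Sum>j\<in>A. (d i j)\<^sup>2)
     = (\<Sum>i\<in>A. \<Sum>j\<in>A. d i j * b i j - d i j * r i - d i j * s j + d i j * t)"
    by (intro sum.cong refl) (simp add: d_def power2_eq_square algebra_simps)
  also have "\<dots> = (\<Sum>i\<in>A. \<Sum>j\<in>A. d i j * b i j)"
    by (simp add: sum.distrib sum_subtractf sd)
  finally have dd: "(\<Sum>i\<in>A. \<Sum>j\<in>A. (d i j)\<^sup>2) = (\<Sum>i\<in>A. \<Sum>j\<in>A. d i j * b i j)" .
  have "0 \<le> (\<Sum>i\<in>A. \<Sum>j\<in>A. (b i j - d i j)\<^sup>2)" by (intro sum_nonneg) simp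
  also have "\<dots> = (\<Sum>i\<in>A. \<Sum>j\<in>A. (b i j)\<^sup>2 - 2 * (d i j * b i j) + (d i j)\<^sup>2)"
    by (intro sum.cong refl) (simp add: power2_eq_square algebra_simps)
  also have "\<dots> = (\<Sum>i\<in>A. \<Sum>j\<in>A. (b i j)\<^sup>2) - (\<Sum>i\<in>A. \<Sum>j\<in>A. (d i j)\<^sup>2)"
    by (simp add: sum.distrib sum_subtractf sum_distrib_left[symmetric] dd)
  finally have le: "(\<Sum>i\<in>A. \<Sum>j\<in>A. (d i j)\<^sup>2) \<le> (\<Sum>i\<in>A. \<Sum>j\<in>A. (b i j)\<^sup>2)" by simp
  have "(\<Sum>i\<in>A. \<Sum>j\<in>A. d i j * b i j)
     = (\<Sum>i\<in>A. \<Sum>j\<in>A. (b i j)\<^sup>2 - r i * b i j - s j * b i j + t * b i j)"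
    by (intro sum.cong refl) (simp add: d_def power2_eq_square algebra_simps)
  also have "\<dots> = (\<Sum>i\<in>A. \<Sum>j\<in>A. (b i j)\<^sup>2) - (\<Sum>i\<in>A. \<Sum>j\<in>A. r i * b i j)
     - (\<Sum>i\<in>A. \<Sum>j\<in>A. s j * b i j) + (\<Sum>i\<in>A. \<Sum>j\<in>A. t * b i j)"
    by (simp only: sum.distrib sum_subtractf)
  also have "(\<Sum>i\<in>A. \<Sum>j\<in>A. s j * b i j) = (\<Sum>j\<in>A. \<Sum>i\<in>A. s j * b i j)" by (rule sum.swap)
  also have "\<dots> = (\<Sum>k\<in>A. (\<Sum>i\<in>A. b i k)\<^sup>2) / h"
    unfolding sum_distrib_left[symmetric] sum_divide_distrib
    by (intro sum.cong refl) (simp add: s_def power2_eq_square)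
  also have "(\<Sum>i\<in>A. \<Sum>j\<in>A. r i * b i j) = (\<Sum>i\<in>A. (\<Sum>j\<in>A. b i j)\<^sup>2) / h"
    unfolding sum_distrib_left[symmetric] sum_divide_distrib
    by (intro sum.cong refl) (simp add: r_def power2_eq_square)
  also have "(\<Sum>i\<in>A. \<Sum>j\<in>A. t * b i j) = (h * t)\<^sup>2"
    unfolding sum_distrib_left[symmetric] using h by (simp add: t_def power2_eq_square)
  \<comment> \<open>The contribution \<open>(h * t)\<^sup>2\<close> of the overall mean is
    nonnegative and is dropped.\<close>
  finally have "(\<Sum>i\<in>A. \<Sum>j\<in>A. (b i j)\<^sup>2) - (\<Sum>i\<in>A. (\<Sum>j\<in>A. b i j)\<^sup>2) / h
     - (\<Sum>k\<in>A. (\<Sum>i\<in>A. b i k)\<^sup>2) / h \<le> (\<Sum>i\<in>A. \<Sum>j\<in>A. (d i j)\<^sup>2)"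
    unfolding dd by simp
  moreover have "card A * (block_mass b A - block_bias b A) = (\<Sum>i\<in>A. \<Sum>j\<in>A. (b i j)\<^sup>2)
     - (\<Sum>i\<in>A. (\<Sum>j\<in>A. b i j)\<^sup>2) / h - (\<Sum>k\<in>A. (\<Sum>i\<in>A. b i k)\<^sup>2) / h"
    using h by (simp add: block_mass_def block_bias_def h_def[symmetric] field_simps power2_eq_square)
  ultimately show thesis using that[of d "h * t"] row col perm le by simp
qed

text \<open>\<open>U\<close> is twice the variance of \<open>u\<close>; double centring removes only
  a constant from \<open>u\<close>, so \<open>U\<close> is twice the centred mass over
  \<open>card A - 1\<close>.\<close>

lemma linear_spread_bounds:
  fixes b :: "'a \<Rightarrow> 'a \<Rightarrow> real"
  assumes fin: "finite A" and c2: "card A \<ge> 2"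
  defines "u \<equiv> \<lambda>p. \<Sum>i\<in>A. b i (p i)"
  defines "U \<equiv> pavg A (\<lambda>x. pavg A (\<lambda>x'. (u x - u x')\<^sup>2))"
  shows "2 * (block_mass b A - block_bias b A) \<le> U" "U \<le> 4 * block_mass b A"
proof -
  define h where "h = real (card A)"
  have h: "h \<ge> 2" using c2 by (simp add: h_def)
  have ne: "A \<noteq> {}" using c2 by auto
  obtain d c where row': "\<forall>i\<in>A. (\<Sum>j\<in>A. d i j) = 0"
    and col': "\<forall>j\<in>A. (\<Sum>i\<in>A. d i j) = 0"
    and u': "\<forall>p. p permutes A \<longrightarrow> (\<Sum>i\<in>A. b i (p i)) = c + (\<Sum>i\<in>A. d i (p i))"
    and le: "(\<Sum>i\<in>A. \<Sum>j\<in>A. (d i j)\<^sup>2) \<le> (\<Sum>i\<in>A. \<Sum>j\<in>A. (b i j)\<^sup>2)" (is "?d \<le> ?b")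
    and ge: "card A * (block_mass b A - block_bias b A) \<le> (\<Sum>i\<in>A. \<Sum>j\<in>A. (d i j)\<^sup>2)"
    by (rule double_centring[OF fin ne, of b])
  note row = bspec[OF row'] and col = bspec[OF col'] and u = u'[rule_format]
  let ?v = "\<lambda>p. \<Sum>i\<in>A. d i (p i)"
  have "U = pavg A (\<lambda>x. pavg A (\<lambda>x'. (?v x)\<^sup>2 + (?v x')\<^sup>2 - 2 * (?v x * ?v x')))"
    unfolding U_def u_def by (intro pavg_cong) (simp add: u power2_eq_square algebra_simps)
  also have "\<dots> = 2 * pavg A (\<lambda>x. (?v x)\<^sup>2) - 2 * (pavg A ?v * pavg A ?v)"
    by (simp only: pavg_add pavg_diff pavg_cmult pavg_cmult_right pavg_const[OF fin])
  also have "\<dots> = 2 * ?d / (h - 1)"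
    using pavg_linear_square[of A d, OF fin c2 row col] pavg_linear_centred[of A d, OF fin row]
    by (simp add: h_def)
  finally have U: "U = 2 * ?d / (h - 1)" .
  have d0: "0 \<le> ?d" by (intro sum_nonneg) simp
  have "block_mass b A - block_bias b A \<le> ?d / h"
    using ge h by (simp add: h_def[symmetric] field_simps)
  also have "\<dots> \<le> ?d / (h - 1)" using h d0 by (intro divide_left_mono) auto
  finally show "2 * (block_mass b A - block_bias b A) \<le> U" unfolding U by simp
  \<comment> \<open>With at least two points, \<open>h - 1 \<ge> h / 2\<close>.\<close>
  have "?d / (h - 1) \<le> ?b / (h / 2)" using h d0 le by (intro frac_le) auto
  thus "U \<le> 4 * block_mass b A" unfolding U block_mass_def h_def[symmetric] by simp
qed

text \<open>After reindexing by \<open>r\<close>, positions in \<open>A\<close> are moved only by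
  \<open>s\<close> and those in \<open>B\<close> only by \<open>t\<close>. So on this coset of the
  product group a linear function is a sum of separated variables.\<close>

lemma permutes_coset_decomposition:
  fixes b :: "'a \<Rightarrow> 'a \<Rightarrow> real"
  assumes N: "finite N" "N = A \<union> B" "A \<inter> B = {}"
    and r: "r permutes N" and s: "s permutes A" and t: "t permutes B"
  shows "(\<Sum>i\<in>N. b i ((p \<circ> s \<circ> t \<circ> inv r) i))
    = (\<Sum>i\<in>A. b (r i) (p (s i))) + (\<Sum>i\<in>B. b (r i) (p (t i)))"
proof -
  have "(\<Sum>i\<in>N. b i ((p \<circ> s \<circ> t \<circ> inv r) i)) = (\<Sum>i\<in>N. b (r i) ((p \<circ> s \<circ> t \<circ> inv r) (r i)))"
    using sum.reindex_bij_betw[OF permutes_imp_bij[OF r], of "\<lambda>i. b i ((p \<circ> s \<circ> t \<circ> inv r) i)"] by simp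
  also have "\<dots> = (\<Sum>i\<in>N. b (r i) (p (s (t i))))"
    using permutes_inverses[OF r] by simp
  also have "\<dots> = (\<Sum>i\<in>A. b (r i) (p (s (t i)))) + (\<Sum>i\<in>B. b (r i) (p (s (t i))))"
    using N by (simp add: sum.union_disjoint)
  also have "(\<Sum>i\<in>A. b (r i) (p (s (t i)))) = (\<Sum>i\<in>A. b (r i) (p (s i)))"
    using permutes_not_in[OF t] N(3) by (intro sum.cong refl) (metis disjoint_iff)
  also have "(\<Sum>i\<in>B. b (r i) (p (s (t i)))) = (\<Sum>i\<in>B. b (r i) (p (t i)))"
    using permutes_not_in[OF s] permutes_in_image[OF t] N
    by (intro sum.cong refl) (metis disjoint_iff)
  finally show ?thesis .
qed

text \<open>For fixed \<open>r\<close>, \<open>s\<close>, \<open>t\<close> the argument of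
  \<open>H\<close> is a right translate of \<open>p\<close>, so averaging over \<open>p\<close>
  alone already gives the full mean.\<close>

lemma pavg_coset_average:
  assumes N: "finite N" "A \<subseteq> N" "B \<subseteq> N"
  shows "pavg N (\<lambda>r. pavg N (\<lambda>p. pavg A (\<lambda>s. pavg B (\<lambda>t. H (p \<circ> s \<circ> t \<circ> inv r))))) = pavg N H"
proof -
  have fin: "finite A" "finite B" using N finite_subset by auto
  have "pavg N (\<lambda>p. pavg A (\<lambda>s. pavg B (\<lambda>t. H (p \<circ> s \<circ> t \<circ> inv r)))) = pavg N H"
    if r: "r permutes N" for r
  proof -
    have "pavg N (\<lambda>p. pavg A (\<lambda>s. pavg B (\<lambda>t. H (p \<circ> s \<circ> t \<circ> inv r))))
      = pavg A (\<lambda>s. pavg N (\<lambda>p. pavg B (\<lambda>t. H (p \<circ> s \<circ> t \<circ> inv r))))"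
      by (rule pavg_commute)
    also have "\<dots> = pavg A (\<lambda>s. pavg B (\<lambda>t. pavg N (\<lambda>p. H (p \<circ> s \<circ> t \<circ> inv r))))"
      by (intro pavg_cong pavg_commute)
    also have "\<dots> = pavg A (\<lambda>s. pavg B (\<lambda>t. pavg N H))"
    proof (rule pavg_cong, rule pavg_cong)
      fix s t assume st: "s permutes A" "t permutes B"
      have "(s \<circ> t \<circ> inv r) permutes N"
        using permutes_subset[OF st(1) N(2)] permutes_subset[OF st(2) N(3)] permutes_inv[OF r]
        by (intro permutes_compose)
      from pavg_compose_right[OF this, of H]
      show "pavg N (\<lambda>p. H (p \<circ> s \<circ> t \<circ> inv r)) = pavg N H" by (simp only: comp_assoc)
    qed
    finally show ?thesis using fin by (simp add: pavg_const)
  qed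
  hence "pavg N (\<lambda>r. pavg N (\<lambda>p. pavg A (\<lambda>s. pavg B (\<lambda>t. H (p \<circ> s \<circ> t \<circ> inv r)))))
     = pavg N (\<lambda>r. pavg N H)" by (rule pavg_cong)
  thus ?thesis using N by (simp add: pavg_const)
qed

text \<open>A row sum in a random block is a partial sum of a centred row, so its mean square is at
  most \<open>card A / card N\<close> times the square sum of that row. Averaging over
  \<open>r\<close> spreads the total mass evenly over the rows.\<close>

lemma pavg_block_bias_le:
  fixes b :: "'a \<Rightarrow> 'a \<Rightarrow> real"
  assumes fin: "finite N" and AN: "A \<subseteq> N" and A0: "A \<noteq> {}"
    and row: "\<And>i. i \<in> N \<Longrightarrow> (\<Sum>j\<in>N. b i j) = 0"
    and col: "\<And>j. j \<in> N \<Longrightarrow> (\<Sum>i\<in>N. b i j) = 0"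
    and S: "(\<Sum>i\<in>N. \<Sum>j\<in>N. (b i j)\<^sup>2) \<le> card N" (is "?S \<le> _")
  shows "pavg N (\<lambda>r. pavg N (\<lambda>p. block_bias (\<lambda>i k. b (r i) (p k)) A)) \<le> 2 / card N"
proof -
  let ?n = "real (card N)" and ?h = "real (card A)"
  have finA: "finite A" using fin AN finite_subset by auto
  have h: "?h > 0" using finA A0 by (simp add: card_gt_0_iff)
  have n: "?n > 0" using fin AN A0 by (auto simp: card_gt_0_iff)
  \<comment> \<open>Stated for a general matrix so that the column part follows from the
    transpose.\<close>
  have one: "pavg N (\<lambda>r. pavg N (\<lambda>p. (\<Sum>i\<in>A. (\<Sum>k\<in>A. c (r i) (p k))\<^sup>2))) \<le> ?h\<^sup>2 / ?n"
    if row: "\<And>i. i \<in> N \<Longrightarrow> (\<Sum>j\<in>N. c i j) = 0"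
      and S: "(\<Sum>i\<in>N. \<Sum>j\<in>N. (c i j)\<^sup>2) \<le> ?n" for c :: "'a \<Rightarrow> 'a \<Rightarrow> real"
  proof -
    have "pavg N (\<lambda>r. pavg N (\<lambda>p. (\<Sum>i\<in>A. (\<Sum>k\<in>A. c (r i) (p k))\<^sup>2)))
      = (\<Sum>i\<in>A. pavg N (\<lambda>r. pavg N (\<lambda>p. (\<Sum>k\<in>A. c (r i) (p k))\<^sup>2)))"
      by (simp only: pavg_sum)
    also have "\<dots> \<le> (\<Sum>i\<in>A. pavg N (\<lambda>r. ?h / ?n * (\<Sum>j\<in>N. (c (r i) j)\<^sup>2)))"
    proof (intro sum_mono pavg_mono)
      fix i r assume i: "i \<in> A" and r: "r permutes N"
      have "r i \<in> N" using permutes_in_image[OF r] i AN by auto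
      from pavg_square_partial_sum_le[OF fin AN row[OF this]]
      show "pavg N (\<lambda>p. (\<Sum>k\<in>A. c (r i) (p k))\<^sup>2) \<le> ?h / ?n * (\<Sum>j\<in>N. (c (r i) j)\<^sup>2)" .
    qed
    also have "\<dots> = (\<Sum>i\<in>A. ?h / ?n * ((\<Sum>i\<in>N. \<Sum>j\<in>N. (c i j)\<^sup>2) / ?n))"
      unfolding pavg_cmult
    proof (intro sum.cong refl arg_cong2[where f="(*)"])
      fix i assume "i \<in> A"
      hence "i \<in> N" using AN by auto
      from pavg_marginal[OF fin this, of "\<lambda>x. \<Sum>j\<in>N. (c x j)\<^sup>2"]
      show "pavg N (\<lambda>r. \<Sum>j\<in>N. (c (r i) j)\<^sup>2) = (\<Sum>i\<in>N. \<Sum>j\<in>N. (c i j)\<^sup>2) / ?n" .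
    qed
    also have "\<dots> = ?h\<^sup>2 / ?n * ((\<Sum>i\<in>N. \<Sum>j\<in>N. (c i j)\<^sup>2) / ?n)"
      by (simp add: power2_eq_square)
    also have "\<dots> \<le> ?h\<^sup>2 / ?n * 1"
      using S n by (intro mult_left_mono) auto
    finally show ?thesis by simp
  qed
  have S': "(\<Sum>j\<in>N. \<Sum>i\<in>N. (b i j)\<^sup>2) \<le> ?n" using S by (subst sum.swap) simp
  have "pavg N (\<lambda>r. pavg N (\<lambda>p. (\<Sum>k\<in>A. (\<Sum>i\<in>A. b (r i) (p k))\<^sup>2)))
     = pavg N (\<lambda>p. pavg N (\<lambda>r. (\<Sum>k\<in>A. (\<Sum>i\<in>A. b (r i) (p k))\<^sup>2)))" by (rule pavg_commute)
  also have "\<dots> \<le> ?h\<^sup>2 / ?n" using one[of "\<lambda>j i. b i j", OF col S'] by simp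
  finally have two: "pavg N (\<lambda>r. pavg N (\<lambda>p. (\<Sum>k\<in>A. (\<Sum>i\<in>A. b (r i) (p k))\<^sup>2))) \<le> ?h\<^sup>2 / ?n" .
  have "pavg N (\<lambda>r. pavg N (\<lambda>p. block_bias (\<lambda>i k. b (r i) (p k)) A)) =
    (pavg N (\<lambda>r. pavg N (\<lambda>p. (\<Sum>i\<in>A. (\<Sum>k\<in>A. b (r i) (p k))\<^sup>2)))
     + pavg N (\<lambda>r. pavg N (\<lambda>p. (\<Sum>k\<in>A. (\<Sum>i\<in>A. b (r i) (p k))\<^sup>2)))) / ?h\<^sup>2"
    unfolding block_bias_def by (simp only: pavg_add pavg_divide)
  also have "\<dots> \<le> (?h\<^sup>2 / ?n + ?h\<^sup>2 / ?n) / ?h\<^sup>2"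
    by (intro divide_right_mono add_mono one row S two) auto
  also have "\<dots> = 2 / ?n" using h by (simp add: field_simps)
  finally show ?thesis .
qed

text \<open>Disjointness of \<open>A\<close> and \<open>B\<close> makes both the row positions and
  the column positions of a pair distinct. The two-point marginals over \<open>r\<close> and
  \<open>p\<close> then average exactly over pairs of entries in different rows and different
  columns.\<close>

lemma pavg_block_mass_product:
  fixes b :: "'a \<Rightarrow> 'a \<Rightarrow> real"
  assumes fin: "finite N" and AN: "A \<subseteq> N" and BN: "B \<subseteq> N" and dis: "A \<inter> B = {}"
    and A0: "A \<noteq> {}" and B0: "B \<noteq> {}"
  shows "pavg N (\<lambda>r. pavg N (\<lambda>p. block_mass (\<lambda>i k. b (r i) (p k)) A * block_mass (\<lambda>i k. b (r i) (p k)) B))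
    = card A * card B * (\<Sum>i\<in>N. \<Sum>j\<in>N. (b i j)\<^sup>2 * (\<Sum>k\<in>N - {i}. \<Sum>l\<in>N - {j}. (b k l)\<^sup>2))
       / (card N * (real (card N) - 1))\<^sup>2" (is "_ = _ * ?NC / ?M\<^sup>2")
proof -
  have finA: "finite A" and finB: "finite B" using fin AN BN finite_subset by auto
  have h: "card A \<noteq> 0" "card B \<noteq> 0" using finA A0 finB B0 by auto
  have pt: "pavg N (\<lambda>r. pavg N (\<lambda>p. (b (r i) (p k))\<^sup>2 * (b (r i') (p k'))\<^sup>2)) = ?NC / ?M\<^sup>2"
    if "i \<in> A" "k \<in> A" "i' \<in> B" "k' \<in> B" for i k i' k'
  proof -
    have N: "i \<in> N" "i' \<in> N" "i \<noteq> i'" "k \<in> N" "k' \<in> N" "k \<noteq> k'" using that AN BN dis by auto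
    have "pavg N (\<lambda>r. pavg N (\<lambda>p. (b (r i) (p k))\<^sup>2 * (b (r i') (p k'))\<^sup>2))
      = pavg N (\<lambda>r. (\<Sum>j\<in>N. \<Sum>l\<in>N - {j}. (b (r i) j)\<^sup>2 * (b (r i') l)\<^sup>2) / ?M)"
    proof (rule pavg_cong)
      fix r :: "'a \<Rightarrow> 'a"
      show "pavg N (\<lambda>p. (b (r i) (p k))\<^sup>2 * (b (r i') (p k'))\<^sup>2)
        = (\<Sum>j\<in>N. \<Sum>l\<in>N - {j}. (b (r i) j)\<^sup>2 * (b (r i') l)\<^sup>2) / ?M"
        by (rule pavg_marginal2[OF fin N(4-6), of "\<lambda>x y. (b (r i) x)\<^sup>2 * (b (r i') y)\<^sup>2"])
    qed
    also have "\<dots> = (\<Sum>x\<in>N. \<Sum>y\<in>N - {x}. \<Sum>j\<in>N. \<Sum>l\<in>N - {j}. (b x j)\<^sup>2 * (b y l)\<^sup>2) / ?M / ?M"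
      unfolding pavg_divide
      using pavg_marginal2[OF fin N(1-3), of "\<lambda>x y. \<Sum>j\<in>N. \<Sum>l\<in>N - {j}. (b x j)\<^sup>2 * (b y l)\<^sup>2"]
      by simp
    also have "(\<Sum>x\<in>N. \<Sum>y\<in>N - {x}. \<Sum>j\<in>N. \<Sum>l\<in>N - {j}. (b x j)\<^sup>2 * (b y l)\<^sup>2) = ?NC"
    proof (rule sum.cong[OF refl])
      fix x
      have "(\<Sum>y\<in>N - {x}. \<Sum>j\<in>N. \<Sum>l\<in>N - {j}. (b x j)\<^sup>2 * (b y l)\<^sup>2)
        = (\<Sum>j\<in>N. \<Sum>y\<in>N - {x}. \<Sum>l\<in>N - {j}. (b x j)\<^sup>2 * (b y l)\<^sup>2)" by (rule sum.swap)
      thus "(\<Sum>y\<in>N - {x}. \<Sum>j\<in>N. \<Sum>l\<in>N - {j}. (b x j)\<^sup>2 * (b y l)\<^sup>2)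
        = (\<Sum>j\<in>N. (b x j)\<^sup>2 * (\<Sum>k\<in>N - {x}. \<Sum>l\<in>N - {j}. (b k l)\<^sup>2))"
        by (simp only: sum_distrib_left)
    qed
    finally show ?thesis by (simp add: power2_eq_square)
  qed
  have "block_mass c A * block_mass c B = (\<Sum>i\<in>A. \<Sum>k\<in>A. \<Sum>i'\<in>B. \<Sum>k'\<in>B.
      (c i k)\<^sup>2 * (c i' k')\<^sup>2) / (card A * card B)" for c :: "'a \<Rightarrow> 'a \<Rightarrow> real"
    unfolding block_mass_def times_divide_times_eq
    unfolding sum_distrib_right unfolding sum_distrib_left by simp
  hence "pavg N (\<lambda>r. pavg N (\<lambda>p. block_mass (\<lambda>i k. b (r i) (p k)) A * block_mass (\<lambda>i k. b (r i) (p k)) B))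
    = (\<Sum>i\<in>A. \<Sum>k\<in>A. \<Sum>i'\<in>B. \<Sum>k'\<in>B.
        pavg N (\<lambda>r. pavg N (\<lambda>p. (b (r i) (p k))\<^sup>2 * (b (r i') (p k'))\<^sup>2))) / (card A * card B)"
    by (simp only: pavg_divide pavg_sum)
  also have "\<dots> = (\<Sum>i\<in>A. \<Sum>k\<in>A. \<Sum>i'\<in>B. \<Sum>k'\<in>B. ?NC / ?M\<^sup>2) / (card A * card B)"
    by (intro arg_cong2[where f="(/)"] sum.cong refl pt)
  also have "\<dots> = card A * card B * ?NC / ?M\<^sup>2"
    using h by (simp add: field_simps)
  finally show ?thesis .
qed

text \<open>On a random coset of the product group of two halves, the product of the block masses is
  controlled by the approximation error there and by the biases. Averaging over all cosets turns the
  product into nonconflicting mass and the local errors into the global one.\<close>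

lemma nonconflicting_mass_le:
  fixes b :: "'a \<Rightarrow> 'a \<Rightarrow> real"
  assumes fin: "finite N" and n4: "card N \<ge> 4"
    and row: "\<And>i. i \<in> N \<Longrightarrow> (\<Sum>j\<in>N. b i j) = 0"
    and col: "\<And>j. j \<in> N \<Longrightarrow> (\<Sum>i\<in>N. b i j) = 0"
    and S: "(\<Sum>i\<in>N. \<Sum>j\<in>N. (b i j)\<^sup>2) \<le> card N"
    and sgn: "\<And>p. p permutes N \<Longrightarrow> f p \<in> {-1, 1}"
  shows "(\<Sum>i\<in>N. \<Sum>j\<in>N. (b i j)\<^sup>2 * (\<Sum>k\<in>N - {i}. \<Sum>l\<in>N - {j}. (b k l)\<^sup>2)) / (real (card N) - 1)\<^sup>2
     \<le> 2160 * pavg N (\<lambda>p. (f p - (\<kappa> + (\<Sum>i\<in>N. b i (p i))))\<^sup>2) + 216 / card N"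
    (is "?NC / _ \<le> 2160 * ?e + _")
proof -
  let ?n = "real (card N)"
  obtain A where AN: "A \<subseteq> N" and cA: "card A = card N div 2"
    using obtain_subset_with_card_n[of "card N div 2" N] by (metis div_le_dividend)
  define B where "B = N - A"
  have fA: "finite A" and fB: "finite B" and BN: "B \<subseteq> N" and dis: "A \<inter> B = {}" and un: "N = A \<union> B"
    using AN fin finite_subset by (auto simp: B_def)
  have cB: "card B = card N - card N div 2" using AN fA cA by (simp add: B_def card_Diff_subset)
  have hA2: "card A \<ge> 2" and hB2: "card B \<ge> 2" using n4 cA cB by auto
  have A0: "A \<noteq> {}" and B0: "B \<noteq> {}" using hA2 hB2 by auto
  \<comment> \<open>Even the half rounded down is at least a third of \<open>N\<close>. This bounds
    each block mass by 3, hence each spread by 12, within the limit 30 of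
    \<open>pavg_variance_product_le\<close>.\<close>
  have hA: "?n \<le> 3 * card A" and hB: "?n \<le> 3 * card B"
  proof -
    have "card N \<le> 3 * card A" "card N \<le> 3 * card B" using n4 cA cB by auto
    thus "?n \<le> 3 * card A" "?n \<le> 3 * card B" by linarith+
  qed
  let ?c = "\<lambda>r p i k. b (r i) (p k)"
  let ?H = "\<lambda>p. (f p - (\<kappa> + (\<Sum>i\<in>N. b i (p i))))\<^sup>2"
  have mass3: "block_mass (?c r p) X \<le> 3"
    if r: "r permutes N" and p: "p permutes N" and X: "X \<subseteq> N" "?n \<le> 3 * card X" for r p X
  proof -
    have "(\<Sum>i\<in>X. \<Sum>k\<in>X. (b (r i) (p k))\<^sup>2) \<le> (\<Sum>i\<in>X. \<Sum>k\<in>N. (b (r i) (p k))\<^sup>2)"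
      by (intro sum_mono sum_mono2 fin X) auto
    also have "\<dots> \<le> (\<Sum>i\<in>N. \<Sum>k\<in>N. (b (r i) (p k))\<^sup>2)"
      by (intro sum_mono2 fin X sum_nonneg) auto
    also have "\<dots> = (\<Sum>i\<in>N. \<Sum>k\<in>N. (b (r i) k)\<^sup>2)"
      by (intro sum.cong refl sum.reindex_bij_betw[OF permutes_imp_bij[OF p]])
    also have "\<dots> = (\<Sum>i\<in>N. \<Sum>k\<in>N. (b i k)\<^sup>2)"
      by (rule sum.reindex_bij_betw[OF permutes_imp_bij[OF r], of "\<lambda>i. \<Sum>k\<in>N. (b i k)\<^sup>2"])
    also have "\<dots> \<le> 3 * card X" using S X by simp
    finally show ?thesis using X n4 by (simp add: block_mass_def field_simps)
  qed
  have key: "block_mass (?c r p) A * block_mass (?c r p) B \<le>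
     240 * pavg A (\<lambda>s. pavg B (\<lambda>t. ?H (p \<circ> s \<circ> t \<circ> inv r)))
     + 6 * (block_bias (?c r p) A + block_bias (?c r p) B)"
    if r: "r permutes N" and p: "p permutes N" for r p
  proof -
    let ?u = "\<lambda>s. \<Sum>i\<in>A. ?c r p i (s i)" and ?v = "\<lambda>t. \<Sum>i\<in>B. ?c r p i (t i)"
    let ?U = "pavg A (\<lambda>x. pavg A (\<lambda>x'. (?u x - ?u x')\<^sup>2))"
    let ?V = "pavg B (\<lambda>x. pavg B (\<lambda>x'. (?v x - ?v x')\<^sup>2))"
    let ?QA = "block_mass (?c r p) A" and ?QB = "block_mass (?c r p) B"
    let ?eA = "block_bias (?c r p) A" and ?eB = "block_bias (?c r p) B"
    let ?g = "\<lambda>s t. f (p \<circ> s \<circ> t \<circ> inv r) - \<kappa>"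
    have Q3: "?QA \<le> 3" "?QB \<le> 3" using mass3[OF r p] AN BN hA hB by auto
    have UA: "2 * (?QA - ?eA) \<le> ?U" "?U \<le> 4 * ?QA"
      using linear_spread_bounds[OF fA hA2, of "?c r p"] by auto
    have VB: "2 * (?QB - ?eB) \<le> ?V" "?V \<le> 4 * ?QB"
      using linear_spread_bounds[OF fB hB2, of "?c r p"] by auto
    have Q0: "0 \<le> ?QA" "0 \<le> ?QB" unfolding block_mass_def by (intro divide_nonneg_nonneg sum_nonneg; simp)+
    have e0: "0 \<le> ?eA" "0 \<le> ?eB" unfolding block_bias_def
      by (intro divide_nonneg_nonneg add_nonneg_nonneg sum_nonneg; simp)+
    have U0: "0 \<le> ?U" and V0: "0 \<le> ?V" by (intro pavg_nonneg zero_le_power2)+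
    have sg: "f (p \<circ> s \<circ> t \<circ> inv r) \<in> {-1, 1}" if "s permutes A" "t permutes B" for s t
      using permutes_subset[OF that(1) AN] permutes_subset[OF that(2) BN] permutes_inv[OF r] p
      by (intro sgn permutes_compose)
    have "?U * ?V \<le> 960 * pavg A (\<lambda>s. pavg B (\<lambda>t. (f (p \<circ> s \<circ> t \<circ> inv r) - (?u s + \<kappa>) - ?v t)\<^sup>2))"
      using pavg_variance_product_le[OF fA fB sg, where u="\<lambda>s. ?u s + \<kappa>" and v="?v"] UA VB Q3 by simp
    also have "pavg A (\<lambda>s. pavg B (\<lambda>t. (f (p \<circ> s \<circ> t \<circ> inv r) - (?u s + \<kappa>) - ?v t)\<^sup>2))
      = pavg A (\<lambda>s. pavg B (\<lambda>t. ?H (p \<circ> s \<circ> t \<circ> inv r)))"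
      by (intro pavg_cong) (simp only: permutes_coset_decomposition[OF fin un dis r], simp add: algebra_simps)
    finally have UV: "?U * ?V \<le> 960 * \<dots>" .
    \<comment> \<open>Masses are traded for spreads one at a time; the bounds
      \<open>?QB \<le> 3\<close> and \<open>?U \<le> 12\<close> keep the bias terms linear.\<close>
    have "?QA * ?QB \<le> (?U / 2 + ?eA) * ?QB" using UA Q0 by (intro mult_right_mono) auto
    also have "\<dots> = ?U / 2 * ?QB + ?eA * ?QB" by (simp add: algebra_simps)
    also have "\<dots> \<le> ?U / 2 * (?V / 2 + ?eB) + ?eA * 3"
      using VB Q3 e0 U0 V0 by (intro add_mono mult_left_mono) auto
    also have "\<dots> = ?U * ?V / 4 + ?U * ?eB / 2 + 3 * ?eA" by (simp add: algebra_simps)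
    also have "\<dots> \<le> ?U * ?V / 4 + 12 * ?eB / 2 + 3 * ?eA"
      using UA Q3 e0 V0 by (intro add_mono divide_right_mono mult_right_mono) auto
    finally show ?thesis using UV e0 by simp
  qed
  have "pavg N (\<lambda>r. pavg N (\<lambda>p. block_mass (?c r p) A * block_mass (?c r p) B))
    \<le> pavg N (\<lambda>r. pavg N (\<lambda>p. 240 * pavg A (\<lambda>s. pavg B (\<lambda>t. ?H (p \<circ> s \<circ> t \<circ> inv r)))
     + 6 * (block_bias (?c r p) A + block_bias (?c r p) B)))"
    by (intro pavg_mono key)
  also have "\<dots> = 240 * pavg N (\<lambda>r. pavg N (\<lambda>p. pavg A (\<lambda>s. pavg B (\<lambda>t. ?H (p \<circ> s \<circ> t \<circ> inv r)))))
     + 6 * (pavg N (\<lambda>r. pavg N (\<lambda>p. block_bias (?c r p) A)) + pavg N (\<lambda>r. pavg N (\<lambda>p. block_bias (?c r p) B)))"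
    by (simp only: pavg_add pavg_cmult)
  also have "\<dots> \<le> 240 * ?e + 6 * (2 / ?n + 2 / ?n)"
    unfolding pavg_coset_average[OF fin AN BN, of ?H]
    by (intro add_mono mult_left_mono pavg_block_bias_le[OF fin _ _ row col S] AN BN A0 B0) auto
  finally have le: "card A * card B * ?NC / (?n * (?n - 1))\<^sup>2 \<le> 240 * ?e + 24 / ?n"
    unfolding pavg_block_mass_product[OF fin AN BN dis A0 B0] by simp
  have NC0: "0 \<le> ?NC" by (intro sum_nonneg mult_nonneg_nonneg) auto
  \<comment> \<open>The block sizes are eliminated at the cost of a factor 9, giving 9 * 240 = 2160
    and 9 * 24 = 216.\<close>
  have "?n * ?n \<le> (3 * real (card A)) * (3 * real (card B))" using hA hB by (intro mult_mono) auto
  hence "?n\<^sup>2 * ?NC \<le> (9 * (card A * card B)) * ?NC"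
    using NC0 by (intro mult_right_mono) (auto simp: power2_eq_square)
  hence "?n\<^sup>2 * ?NC / (?n * (?n - 1))\<^sup>2 \<le> (9 * (card A * card B)) * ?NC / (?n * (?n - 1))\<^sup>2"
    by (intro divide_right_mono) auto
  also have "?n\<^sup>2 * ?NC / (?n * (?n - 1))\<^sup>2 = ?NC / (?n - 1)\<^sup>2"
    using n4 by (simp add: power_mult_distrib)
  also have "(9 * (card A * card B)) * ?NC / (?n * (?n - 1))\<^sup>2
    = 9 * (card A * card B * ?NC / (?n * (?n - 1))\<^sup>2)" by simp
  also have "\<dots> \<le> 9 * (240 * ?e + 24 / ?n)" using le by (intro mult_left_mono) auto
  finally show ?thesis by simp
qed

section \<open>Lines of 1-cosets\<close>

abbreviation coset_of :: "nat \<Rightarrow> nat \<times> nat \<Rightarrow> (nat \<Rightarrow> nat) set" where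
  "coset_of n x \<equiv> coset1 n (fst x) (snd x)"

definition symdist :: "nat \<Rightarrow> (nat \<Rightarrow> nat) set \<Rightarrow> (nat \<Rightarrow> nat) set \<Rightarrow> real" where
  "symdist n G F = card ((G - F) \<union> (F - G)) / fact n"

text \<open>Here \<open>e\<close> enumerates the cells of one row or one column, so that both cases
  share their proofs: either way the 1-cosets of the cells partition \<open>Sn n\<close>.\<close>

definition is_line :: "nat \<Rightarrow> (nat \<Rightarrow> nat \<times> nat) \<Rightarrow> bool" where
  "is_line n e \<longleftrightarrow> (\<exists>i\<in>{1..n}. e = (\<lambda>k. (i, k)) \<or> e = (\<lambda>k. (k, i)))"

section \<open>Cardinalities of 1-cosets and of unions along a line\<close>

lemma finite_Sn: "finite (Sn n)"
  by (simp add: Sn_def finite_permutations)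

lemma card_Sn: "card (Sn n) = fact n"
  by (simp add: Sn_def card_permutations)

lemma pavg_of_bool: "pavg {1..n} (\<lambda>p. of_bool (Q p)) = card {p \<in> Sn n. Q p} / fact n"
  by (simp add: pavg_def Sn_def Int_def finite_permutations sum_of_bool_eq)

lemma expect_eq_pavg: "expect n g = pavg {1..n} g"
  by (simp add: expect_def pavg_def Sn_def)

lemma pavg_sign:
  assumes "F \<subseteq> Sn n"
  shows "pavg {1..n} (\<lambda>p. 2 * chi F p - 1) = 2 * (card F / fact n) - 1"
proof -
  have "pavg {1..n} (\<lambda>p. 2 * chi F p - 1) = pavg {1..n} (\<lambda>p. 2 * of_bool (p \<in> F) - 1)"
    by (rule pavg_cong) (simp add: chi_def)
  moreover have "{p \<in> Sn n. p \<in> F} = F" using assms by auto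
  ultimately show ?thesis
    unfolding pavg_diff pavg_cmult pavg_of_bool by (simp add: pavg_const)
qed

lemma card_coset1:
  assumes "i \<in> {1..n}" "j \<in> {1..n}"
  shows "card (coset1 n i j) = fact n / n"
proof -
  have "pavg {1..n} (\<lambda>p. of_bool (p i = j)) = (\<Sum>x\<in>{1..n}. of_bool (x = j)) / real (card {1..n})"
    by (rule pavg_marginal[of "{1..n}" i "\<lambda>x. of_bool (x = j)"]) (use assms in auto)
  also have "\<dots> = 1 / n" using sum_of_bool_single(1)[of "{1..n}" j "\<lambda>_. 1"] assms by simp
  finally show ?thesis unfolding pavg_of_bool coset1_def by (simp add: field_simps)
qed

lemma line_cosets:
  assumes "is_line n e"
  shows "inj e"
    and "k \<in> {1..n} \<Longrightarrow> e k \<in> {1..n} \<times> {1..n}"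
    and "k \<noteq> l \<Longrightarrow> coset_of n (e k) \<inter> coset_of n (e l) = {}"
    and "(\<Union>k\<in>{1..n}. coset_of n (e k)) = Sn n"
proof -
  obtain i where i: "i \<in> {1..n}" and e: "e = (\<lambda>k. (i, k)) \<or> e = (\<lambda>k. (k, i))"
    using assms by (auto simp: is_line_def)
  show "inj e" "k \<in> {1..n} \<Longrightarrow> e k \<in> {1..n} \<times> {1..n}"
    using e i by (auto simp: inj_on_def)
  show "coset_of n (e k) \<inter> coset_of n (e l) = {}" if "k \<noteq> l"
  proof -
    have "p l \<noteq> p k" if "p \<in> Sn n" for p
      using that \<open>k \<noteq> l\<close> permutes_inj[of p] inj_eq[of p k l] by (simp add: Sn_def)
    hence "p \<notin> coset_of n (e k) \<or> p \<notin> coset_of n (e l)" for p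
      using e that by (auto simp: coset1_def)
    thus ?thesis by blast
  qed
  show "(\<Union>k\<in>{1..n}. coset_of n (e k)) = Sn n"
  proof (intro equalityI subsetI)
    fix p assume "p \<in> Sn n"
    hence p: "p permutes {1..n}" by (simp add: Sn_def)
    have "p i \<in> {1..n}" using permutes_in_image[OF p] i by simp
    moreover obtain k where "k \<in> {1..n}" "p k = i" using permutes_image[OF p] i by (metis imageE)
    ultimately show "p \<in> (\<Union>k\<in>{1..n}. coset_of n (e k))"
      using e p by (auto simp: coset1_def Sn_def)
  qed (auto simp: coset1_def)
qed

lemma card_line_union:
  assumes e: "is_line n e" and J: "J \<subseteq> {1..n}"
  shows "card (\<Union>k\<in>J. coset_of n (e k) \<inter> X) = (\<Sum>k\<in>J. card (coset_of n (e k) \<inter> X))"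
proof (rule card_UN_disjoint)
  show "finite J" using J finite_subset by blast
  show "\<forall>k\<in>J. finite (coset_of n (e k) \<inter> X)"
    by (auto simp: coset1_def intro: finite_subset[OF _ finite_Sn])
  show "\<forall>k\<in>J. \<forall>l\<in>J. k \<noteq> l \<longrightarrow> coset_of n (e k) \<inter> X \<inter> (coset_of n (e l) \<inter> X) = {}"
    using line_cosets(3)[OF e] by blast
qed

lemma card_line_cosets:
  assumes e: "is_line n e" and J: "J \<subseteq> {1..n}"
  shows "card (\<Union>k\<in>J. coset_of n (e k)) = card J * (fact n / real n)"
proof -
  have "card (\<Union>k\<in>J. coset_of n (e k)) = (\<Sum>k\<in>J. card (coset_of n (e k)))"
    using card_line_union[OF e J, of UNIV] by simp
  also have "real \<dots> = (\<Sum>k\<in>J. fact n / real n)"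
    unfolding of_nat_sum using line_cosets(2)[OF e] J
    by (intro sum.cong refl card_coset1) (auto simp: mem_Times_iff subset_iff)
  finally show ?thesis by simp
qed

section \<open>Normalised symmetric difference; rounding and majority along a line\<close>

lemma symdist_triangle:
  assumes "G \<subseteq> Sn n" "G' \<subseteq> Sn n" "F \<subseteq> Sn n"
  shows "symdist n G' F \<le> symdist n G' G + symdist n G F"
proof -
  have "card ((G' - F) \<union> (F - G')) \<le> card (((G' - G) \<union> (G - G')) \<union> ((G - F) \<union> (F - G)))"
    by (intro card_mono finite_subset[OF _ finite_Sn[of n]]) (use assms in auto)
  also have "\<dots> \<le> card ((G' - G) \<union> (G - G')) + card ((G - F) \<union> (F - G))"
    by (rule card_Un_le)
  finally have "real (card ((G' - F) \<union> (F - G')))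
     \<le> real (card ((G' - G) \<union> (G - G'))) + real (card ((G - F) \<union> (F - G)))" by linarith
  thus ?thesis by (simp add: symdist_def add_divide_distrib[symmetric] divide_right_mono)
qed

lemma card_diff_le_symdist:
  assumes "G \<subseteq> Sn n" "F \<subseteq> Sn n"
  shows "\<bar>real (card G) - real (card F)\<bar> / fact n \<le> symdist n G F"
proof -
  have fin: "finite G" "finite F" using assms finite_Sn finite_subset by blast+
  have "card G \<le> card (F \<union> ((G - F) \<union> (F - G)))" "card F \<le> card (G \<union> ((G - F) \<union> (F - G)))"
    using fin by (auto intro!: card_mono)
  moreover have "card (F \<union> ((G - F) \<union> (F - G))) \<le> card F + card ((G - F) \<union> (F - G))"
    "card (G \<union> ((G - F) \<union> (F - G))) \<le> card G + card ((G - F) \<union> (F - G))"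
    by (rule card_Un_le)+
  ultimately have "\<bar>real (card G) - real (card F)\<bar> \<le> real (card ((G - F) \<union> (F - G)))" by linarith
  thus ?thesis by (simp add: symdist_def divide_right_mono)
qed

text \<open>The bound on \<open>D\<close> will carry a factor 1/\<eta>, which the density estimate
  must not have. Adjusting the number of cosets to the integer part of \<open>c * n\<close> makes
  the density correct up to \<open>1 / n\<close> and at most doubles the distance, apart from
  another \<open>1 / n\<close>.\<close>

lemma line_rounding:
  assumes e: "is_line n e" and J: "J \<subseteq> {1..n}" and F: "F \<subseteq> Sn n" and cF: "real (card F) = c * fact n"
    and c: "0 < c" "c < 1" and n: "n \<ge> 1"
    and D: "symdist n (\<Union>k\<in>J. coset_of n (e k)) F \<le> D"
  obtains K where "K \<subseteq> {1..n}" "\<bar>real (card K) / n - c\<bar> \<le> 1 / n"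
    "symdist n (\<Union>k\<in>K. coset_of n (e k)) F \<le> 2 * D + 1 / n"
proof -
  let ?G = "\<lambda>J. \<Union>k\<in>J. coset_of n (e k)"
  have finJ: "finite J" using J finite_subset by blast
  have GS: "?G X \<subseteq> Sn n" for X by (auto simp: coset1_def)
  define t where "t = nat \<lfloor>c * n\<rfloor>"
  have t: "real t \<le> c * n" "c * n < real t + 1" using c by (auto simp: t_def)
  have tn: "t \<le> n"
  proof -
    have "real t \<le> 1 * n" using t(1) mult_right_mono[of c 1 "real n"] c by linarith
    thus ?thesis by simp
  qed
  have sub: "symdist n (?G X) (?G Y) = (real (card Y) - real (card X)) / n"
    "symdist n (?G Y) (?G X) = (real (card Y) - real (card X)) / n"
    if XY: "X \<subseteq> Y" "Y \<subseteq> {1..n}" for X Y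
  proof -
    have "finite (?G Y)" using GS finite_Sn finite_subset by blast
    moreover have "?G X \<subseteq> ?G Y" using XY by blast
    ultimately have "real (card (?G Y - ?G X)) = real (card (?G Y)) - real (card (?G X))"
      by (simp add: card_Diff_subset finite_subset of_nat_diff card_mono)
    hence "real (card (?G Y - ?G X)) / fact n = (real (card Y) - real (card X)) / n"
      unfolding card_line_cosets[OF e XY(2)] card_line_cosets[OF e subset_trans[OF XY]]
      using n by (simp add: field_simps)
    moreover have "(?G X - ?G Y) \<union> (?G Y - ?G X) = ?G Y - ?G X"
      "(?G Y - ?G X) \<union> (?G X - ?G Y) = ?G Y - ?G X" using XY by blast+
    ultimately show "symdist n (?G X) (?G Y) = (real (card Y) - real (card X)) / n"
      "symdist n (?G Y) (?G X) = (real (card Y) - real (card X)) / n"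
      by (simp_all only: symdist_def)
  qed
  \<comment> \<open>Nestedness makes the distance between the two unions a plain difference of
    cardinalities.\<close>
  obtain K where K: "K \<subseteq> {1..n}" "card K = t" and nest: "J \<subseteq> K \<or> K \<subseteq> J"
  proof (cases "t \<le> card J")
    case True
    then obtain K where "K \<subseteq> J" "card K = t" using obtain_subset_with_card_n by metis
    thus thesis using that J by blast
  next
    case False
    then obtain K where "J \<subseteq> K" "K \<subseteq> {1..n}" "card K = t"
      using exists_subset_between[of J t "{1..n}"] J tn by auto
    thus thesis using that by blast
  qed
  have KJ: "symdist n (?G K) (?G J) = \<bar>real (card J) - real t\<bar> / n"
    using nest
  proof
    assume "J \<subseteq> K"
    moreover have "card J \<le> t" using calculation K card_mono finite_subset by (metis finite_atLeastAtMost)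
    ultimately show ?thesis using sub(2)[of J K] K by simp
  next
    assume "K \<subseteq> J"
    moreover have "t \<le> card J" using calculation K finJ card_mono by metis
    ultimately show ?thesis using sub(1)[of K J] K J by simp
  qed
  \<comment> \<open>The old density is already within \<open>D\<close> of \<open>c\<close>, since a
    difference of measures is at most the symmetric difference; so few cosets have to be added or
    removed.\<close>
  have "\<bar>real (card J) / n - c\<bar> = \<bar>real (card (?G J)) - real (card F)\<bar> / fact n"
  proof -
    have "(real (card (?G J)) - real (card F)) / fact n = real (card J) / n - c"
      unfolding card_line_cosets[OF e J] cF by (simp add: field_simps)
    hence "\<bar>real (card J) / n - c\<bar> = \<bar>(real (card (?G J)) - real (card F)) / fact n\<bar>" by simp
    thus ?thesis by (simp only: abs_divide abs_of_pos[OF fact_gt_zero])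
  qed
  also have "\<dots> \<le> D" using card_diff_le_symdist[OF GS F, of J] D by simp
  finally have JD: "\<bar>real (card J) / n - c\<bar> \<le> D" .
  have tc: "\<bar>real t / n - c\<bar> \<le> 1 / n"
  proof -
    have "real t / n - c = (real t - c * n) / n" using n by (simp add: field_simps)
    also have "\<bar>\<dots>\<bar> = \<bar>real t - c * n\<bar> / n" by simp
    also have "\<dots> \<le> 1 / n" using t by (intro divide_right_mono) auto
    finally show ?thesis .
  qed
  have "symdist n (?G K) F \<le> symdist n (?G K) (?G J) + symdist n (?G J) F"
    by (rule symdist_triangle[OF GS GS F])
  also have "symdist n (?G K) (?G J) = \<bar>real (card J) / n - real t / n\<bar>"
    unfolding KJ by (simp add: diff_divide_distrib[symmetric])
  also have "\<dots> + symdist n (?G J) F \<le> 2 * D + 1 / n" using JD tc D by linarith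
  finally show thesis using that[of K] K tc by simp
qed

text \<open>A coset is taken exactly when \<open>F\<close> fills more than half of it. The loss on
  it is the smaller of \<open>q k\<close> and \<open>1 - q k\<close>; as the other one is at least
  1/2, the loss is at most twice their product.\<close>

lemma line_majority:
  assumes e: "is_line n e" and F: "F \<subseteq> Sn n" and n: "n \<ge> 1"
  defines "q \<equiv> \<lambda>k. card (coset_of n (e k) \<inter> F) * real n / fact n"
  obtains J where "J \<subseteq> {1..n}"
    "symdist n (\<Union>k\<in>J. coset_of n (e k)) F \<le> (\<Sum>k\<in>{1..n}. 2 * (q k * (1 - q k))) / n"
proof -
  let ?N = "{1..n}" and ?L = "\<lambda>k. coset_of n (e k)"
  define J where "J = {k \<in> ?N. q k > 1 / 2}"
  let ?G = "\<Union>k\<in>J. ?L k"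
  have JN: "J \<subseteq> ?N" by (auto simp: J_def)
  have finL: "finite (?L k)" for k by (auto simp: coset1_def intro: finite_subset[OF _ finite_Sn])
  have cardL: "card (?L k) = fact n / real n" if "k \<in> ?N" for k
    using line_cosets(2)[OF e that] by (intro card_coset1) (auto simp: mem_Times_iff)
  have in_: "card (?L k \<inter> F) = q k * (fact n / real n)" for k
    using n by (simp add: q_def)
  have out: "card (?L k - F) = (1 - q k) * (fact n / real n)" if "k \<in> ?N" for k
  proof -
    have "card (?L k) = card (?L k \<inter> F) + card (?L k - F)"
      using card_Int_Diff[OF finL] .
    hence "real (card (?L k)) = card (?L k \<inter> F) + real (card (?L k - F))" by linarith
    thus ?thesis unfolding cardL[OF that] in_ left_diff_distrib by linarith
  qed
  have q01: "0 \<le> q k" "q k \<le> 1" if "k \<in> ?N" for k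
  proof -
    show "0 \<le> q k" by (simp add: q_def)
    have "0 \<le> (1 - q k) * (fact n / real n)" unfolding out[OF that, symmetric] by simp
    moreover have "(1 - q k) * (fact n / real n) < 0" if "1 < q k"
      using that n by (intro mult_neg_pos) auto
    ultimately show "q k \<le> 1" by (meson not_le)
  qed
  let ?X = "(?G - F) \<union> (F - ?G)"
  have "?X = (\<Union>k\<in>?N. ?L k \<inter> ?X)" using line_cosets(4)[OF e] F by (auto simp: coset1_def)
  hence "card ?X = card (\<Union>k\<in>?N. ?L k \<inter> ?X)" by (rule arg_cong)
  also have "\<dots> = (\<Sum>k\<in>?N. card (?L k \<inter> ?X))" by (rule card_line_union[OF e order_refl])
  finally have "real (card ?X) = (\<Sum>k\<in>?N. real (card (?L k \<inter> ?X)))"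
    by (simp only: of_nat_sum)
  also have "\<dots> \<le> (\<Sum>k\<in>?N. 2 * (q k * (1 - q k)) * (fact n / real n))"
  proof (rule sum_mono)
    fix k assume k: "k \<in> ?N"
    show "real (card (?L k \<inter> ?X)) \<le> 2 * (q k * (1 - q k)) * (fact n / real n)"
    proof (cases "q k > 1 / 2")
      case True
      hence "?L k \<inter> ?X = ?L k - F" using k by (auto simp: J_def)
      hence "real (card (?L k \<inter> ?X)) = (1 - q k) * (fact n / real n)" using out[OF k] by simp
      moreover have "1 * (1 - q k) \<le> (2 * q k) * (1 - q k)"
        using True q01[OF k] by (intro mult_right_mono) auto
      ultimately show ?thesis by (auto intro!: mult_right_mono divide_right_mono)
    next
      case False
      have "k \<notin> J" using False by (simp add: J_def)
      have "?L k \<inter> ?L l = {}" if "l \<in> J" for l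
        using that \<open>k \<notin> J\<close> by (intro line_cosets(3)[OF e]) auto
      hence "?L k \<inter> ?G = {}" by blast
      hence "?L k \<inter> ?X = ?L k \<inter> F" by blast
      hence "real (card (?L k \<inter> ?X)) = q k * (fact n / real n)" using in_ by simp
      moreover have "1 * q k \<le> (2 * (1 - q k)) * q k"
        using False q01[OF k] by (intro mult_right_mono) auto
      hence "q k \<le> 2 * (q k * (1 - q k))" by (simp add: algebra_simps)
      ultimately show ?thesis by (auto intro!: mult_right_mono divide_right_mono)
    qed
  qed
  finally have "real (card ?X) \<le> (\<Sum>k\<in>?N. 2 * (q k * (1 - q k))) * (fact n / real n)"
    by (simp only: sum_distrib_right)
  hence "symdist n ?G F \<le> (\<Sum>k\<in>?N. 2 * (q k * (1 - q k))) / n"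
    using n by (simp add: symdist_def field_simps)
  with JN that show thesis by blast
qed

section \<open>Coefficients and coset means of the projection onto \<open>U1 n\<close>\<close>

lemma T_in_U1:
  assumes "i \<in> {1..n}" "j \<in> {1..n}"
  shows "T n i j \<in> U1 n"
proof -
  have "T n i j = (\<lambda>p. \<Sum>i'\<in>{1..n}. \<Sum>j'\<in>{1..n}. (of_bool (i' = i) * of_bool (j' = j)) * T n i' j' p)"
    using sum_of_bool_single(1)[of "{1..n}"] assms
    by (simp add: mult.assoc sum_distrib_left[symmetric])
  hence "\<exists>a. T n i j = (\<lambda>p. \<Sum>i'\<in>{1..n}. \<Sum>j'\<in>{1..n}. a i' j' * T n i' j' p)"
    by (rule exI[where x="\<lambda>i' j'. of_bool (i' = i) * of_bool (j' = j)"])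
  thus ?thesis unfolding U1_def mem_Collect_eq .
qed

text \<open>Double centring puts the projection into the form constant plus centred linear part.
  Orthogonality to each \<open>T n i j\<close> says that \<open>f\<close> and \<open>f1\<close> have
  equal integrals over every 1-coset, which identifies the constant and the coefficients.\<close>

lemma projection_U1:
  assumes n2: "n \<ge> 2" and proj: "is_proj_U1 n f f1"
    and sgn: "\<And>p. p permutes {1..n} \<Longrightarrow> f p \<in> {-1, 1}"
  defines "\<kappa> \<equiv> pavg {1..n} f"
  obtains b where
    "\<forall>i\<in>{1..n}. (\<Sum>j\<in>{1..n}. b i j) = 0" "\<forall>j\<in>{1..n}. (\<Sum>i\<in>{1..n}. b i j) = 0"
    "expect n (\<lambda>p. (f p - f1 p)\<^sup>2) = pavg {1..n} (\<lambda>p. (f p - (\<kappa> + (\<Sum>i\<in>{1..n}. b i (p i))))\<^sup>2)"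
    "\<forall>i\<in>{1..n}. \<forall>j\<in>{1..n}. pavg {1..n} (\<lambda>p. of_bool (p i = j) * f p) = \<kappa> / n + b i j / (real n - 1)"
    "(\<Sum>i\<in>{1..n}. \<Sum>j\<in>{1..n}. (b i j)\<^sup>2) / (real n - 1) = 1 - \<kappa>\<^sup>2 - expect n (\<lambda>p. (f p - f1 p)\<^sup>2)"
proof -
  let ?N = "{1..n}"
  have fin: "finite ?N" and ne: "?N \<noteq> {}" and c2: "card ?N \<ge> 2" using n2 by auto
  have f1U: "f1 \<in> U1 n" and orth: "\<And>g. g \<in> U1 n \<Longrightarrow> ip n (\<lambda>p. f p - f1 p) g = 0"
    using proj by (auto simp: is_proj_U1_def)
  have ip: "ip n g h = pavg ?N (\<lambda>p. g p * h p)" for g h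
    by (simp add: ip_def pavg_def Sn_def)
  have Tb: "T n i j p = of_bool (p i = j)" if "p permutes ?N" for i j p
    using that by (simp add: T_def coset1_def Sn_def)
  obtain a where a: "f1 = (\<lambda>p. \<Sum>i\<in>?N. \<Sum>j\<in>?N. a i j * T n i j p)"
    using f1U unfolding U1_def by blast
  have f1a: "f1 p = (\<Sum>i\<in>?N. a i (p i))" if p: "p permutes ?N" for p
  proof -
    have "(\<Sum>j\<in>?N. a i j * T n i j p) = a i (p i)" if "i \<in> ?N" for i
    proof -
      have "p i \<in> ?N" using permutes_in_image[OF p] that by simp
      from sum_of_bool_single(2)[OF fin this, of "a i"] show ?thesis
        by (simp add: Tb[OF p] mult.commute)
    qed
    thus ?thesis by (simp add: a)
  qed
  obtain b c where row: "\<forall>i\<in>?N. (\<Sum>j\<in>?N. b i j) = 0" and col: "\<forall>j\<in>?N. (\<Sum>i\<in>?N. b i j) = 0"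
    and ab: "\<forall>p. p permutes ?N \<longrightarrow> (\<Sum>i\<in>?N. a i (p i)) = c + (\<Sum>i\<in>?N. b i (p i))"
    by (rule double_centring[OF fin ne, of a])
  let ?g = "\<lambda>p. \<Sum>i\<in>?N. b i (p i)"
  have f1b: "f1 p = c + ?g p" if "p permutes ?N" for p using f1a[OF that] ab that by simp
  have g0: "pavg ?N ?g = 0" by (rule pavg_linear_centred[OF fin]) (use row in blast)
  have g2: "pavg ?N (\<lambda>p. (?g p)\<^sup>2) = (\<Sum>i\<in>?N. \<Sum>j\<in>?N. (b i j)\<^sup>2) / (real n - 1)"
    using pavg_linear_square[of ?N b, OF fin c2] row col by simp
  have oT: "pavg ?N (\<lambda>p. of_bool (p i = j) * f p) = pavg ?N (\<lambda>p. of_bool (p i = j) * f1 p)"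
    if "i \<in> ?N" "j \<in> ?N" for i j
  proof -
    have "0 = pavg ?N (\<lambda>p. (f p - f1 p) * T n i j p)" using orth[OF T_in_U1[OF that]] by (simp add: ip)
    also have "\<dots> = pavg ?N (\<lambda>p. of_bool (p i = j) * f p - of_bool (p i = j) * f1 p)"
      by (rule pavg_cong) (simp add: Tb algebra_simps)
    finally show ?thesis by (simp add: pavg_diff)
  qed
  \<comment> \<open>The 1-cosets of position 1 partition the group, so equal coset integrals force
    equal means and the constant \<open>c\<close> is \<kappa>.\<close>
  have all: "pavg ?N h = (\<Sum>j\<in>?N. pavg ?N (\<lambda>p. of_bool (p 1 = j) * h p))" for h
    unfolding pavg_sum[symmetric]
  proof (rule pavg_cong)
    fix p assume p: "p permutes ?N"
    have "p 1 \<in> ?N" using permutes_in_image[OF p] n2 by simp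
    from sum_of_bool_single(2)[OF fin this, of "\<lambda>_. h p"]
    show "h p = (\<Sum>j\<in>?N. of_bool (p 1 = j) * h p)" by simp
  qed
  have "\<kappa> = pavg ?N f1"
    unfolding \<kappa>_def all[of f] all[of f1] using n2 by (intro sum.cong refl oT) auto
  also have "\<dots> = pavg ?N (\<lambda>p. c + ?g p)" by (intro pavg_cong f1b)
  also have "\<dots> = c" unfolding pavg_add g0 by (simp add: pavg_const)
  finally have k: "\<kappa> = c" .
  have eps: "expect n (\<lambda>p. (f p - f1 p)\<^sup>2) = pavg ?N (\<lambda>p. (f p - (\<kappa> + ?g p))\<^sup>2)"
    unfolding expect_eq_pavg by (intro pavg_cong) (simp add: f1b k)
  have marg: "pavg ?N (\<lambda>p. of_bool (p i = j) * f p) = \<kappa> / n + b i j / (real n - 1)"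
    if ij: "i \<in> ?N" "j \<in> ?N" for i j
  proof -
    have "pavg ?N (\<lambda>p. of_bool (p i = j) * f p) = pavg ?N (\<lambda>p. of_bool (p i = j) * \<kappa> + of_bool (p i = j) * ?g p)"
      unfolding oT[OF ij] by (rule pavg_cong) (simp add: f1b k algebra_simps)
    also have "\<dots> = pavg ?N (\<lambda>p. of_bool (p i = j)) * \<kappa> + b i j / (real n - 1)"
      unfolding pavg_add pavg_cmult_right
      using pavg_indicator_linear[of ?N i j b, OF fin c2 ij] row col by simp
    also have "pavg ?N (\<lambda>p. of_bool (p i = j)) = 1 / n"
      using card_coset1[OF ij] unfolding pavg_of_bool coset1_def by simp
    finally show ?thesis by simp
  qed
  \<comment> \<open>Pythagoras: the mean square of a sign function is 1, and the cross term vanishes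
    because \<open>f1\<close> itself lies in \<open>U1 n\<close>.\<close>
  have "1 = pavg ?N (\<lambda>p. (f p - f1 p)\<^sup>2 + 2 * ((f p - f1 p) * f1 p) + (f1 p)\<^sup>2)"
  proof -
    have "pavg ?N (\<lambda>p. (f p - f1 p)\<^sup>2 + 2 * ((f p - f1 p) * f1 p) + (f1 p)\<^sup>2) = pavg ?N (\<lambda>p. 1)"
    proof (rule pavg_cong)
      fix p assume "p permutes ?N"
      hence "(f p)\<^sup>2 = 1" using sgn by fastforce
      thus "(f p - f1 p)\<^sup>2 + 2 * ((f p - f1 p) * f1 p) + (f1 p)\<^sup>2 = 1"
        by (simp add: power2_eq_square algebra_simps)
    qed
    thus ?thesis by (simp add: pavg_const)
  qed
  also have "\<dots> = expect n (\<lambda>p. (f p - f1 p)\<^sup>2) + pavg ?N (\<lambda>p. (f1 p)\<^sup>2)"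
    using orth[OF f1U] by (simp add: pavg_add pavg_cmult expect_eq_pavg ip)
  also have "pavg ?N (\<lambda>p. (f1 p)\<^sup>2) = pavg ?N (\<lambda>p. \<kappa>\<^sup>2 + 2 * \<kappa> * ?g p + (?g p)\<^sup>2)"
    by (rule pavg_cong) (simp add: f1b k power2_eq_square algebra_simps)
  also have "\<dots> = \<kappa>\<^sup>2 + (\<Sum>i\<in>?N. \<Sum>j\<in>?N. (b i j)\<^sup>2) / (real n - 1)"
    unfolding pavg_add pavg_cmult g0 g2 by (simp add: pavg_const)
  finally show thesis using that[OF row col eps] marg by simp
qed

section \<open>The dictatorship\<close>

text \<open>Law of total variance along the line: the coset means \<open>2 * q k - 1\<close> have
  mean \<kappa>, and the conditional variance is \<open>4 * (q k * (1 - q k))\<close>, twice the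
  majority loss. So the distance is at most half of the variance that the line leaves
  unexplained.\<close>

lemma line_approximation:
  assumes e: "is_line n e" and F: "F \<subseteq> Sn n" and n2: "n \<ge> 2"
    and \<kappa>: "\<kappa> = pavg {1..n} (\<lambda>p. 2 * chi F p - 1)"
    and marg: "\<forall>i\<in>{1..n}. \<forall>j\<in>{1..n}.
      pavg {1..n} (\<lambda>p. of_bool (p i = j) * (2 * chi F p - 1)) = \<kappa> / n + b i j / (real n - 1)"
  obtains J where "J \<subseteq> {1..n}"
    "symdist n (\<Union>k\<in>J. coset_of n (e k)) F
       \<le> 1 - \<kappa>\<^sup>2 - (\<Sum>k\<in>{1..n}. (b (fst (e k)) (snd (e k)))\<^sup>2) / (real n - 1)"
proof -
  let ?N = "{1..n}"
  define q where "q k = card (coset_of n (e k) \<inter> F) * real n / fact n" for k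
  define B where "B k = b (fst (e k)) (snd (e k))" for k
  \<comment> \<open>The deviation of the coset mean from \<kappa>; the factor
    \<open>n / (n - 1)\<close> comes from normalising the coset integral by the measure
    \<open>1 / n\<close>.\<close>
  define \<beta> where "\<beta> k = B k * (n / (real n - 1))" for k
  have n1: "n \<ge> 1" using n2 by simp
  have q: "2 * q k - 1 = \<kappa> + \<beta> k" if k: "k \<in> ?N" for k
  proof -
    have ij: "fst (e k) \<in> ?N" "snd (e k) \<in> ?N"
      using line_cosets(2)[OF e k] by (auto simp: mem_Times_iff)
    have "pavg ?N (\<lambda>p. of_bool (p (fst (e k)) = snd (e k)) * (2 * chi F p - 1))
      = pavg ?N (\<lambda>p. 2 * of_bool (p (fst (e k)) = snd (e k) \<and> p \<in> F) - of_bool (p (fst (e k)) = snd (e k)))"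
      by (rule pavg_cong) (simp add: chi_def)
    also have "\<dots> = 2 * (card {p \<in> Sn n. p (fst (e k)) = snd (e k) \<and> p \<in> F} / fact n)
       - card (coset_of n (e k)) / fact n"
      unfolding pavg_diff pavg_cmult pavg_of_bool coset1_def ..
    also have "{p \<in> Sn n. p (fst (e k)) = snd (e k) \<and> p \<in> F} = coset_of n (e k) \<inter> F"
      by (auto simp: coset1_def)
    also have "2 * (card (coset_of n (e k) \<inter> F) / fact n) - card (coset_of n (e k)) / fact n = (2 * q k - 1) / n"
      unfolding card_coset1[OF ij] q_def using n2 by (simp add: field_simps)
    finally have "(2 * q k - 1) / n = \<kappa> / n + B k / (real n - 1)" using marg ij by (simp add: B_def)
    hence "(2 * q k - 1) / n = (\<kappa> + \<beta> k) / n" using n2 by (simp add: \<beta>_def add_divide_distrib)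
    thus ?thesis using n2 by simp
  qed
  have sumq: "(\<Sum>k\<in>?N. 2 * q k - 1) = n * \<kappa>"
  proof -
    have "F = (\<Union>k\<in>?N. coset_of n (e k) \<inter> F)" using line_cosets(4)[OF e] F by auto
    hence "card F = card (\<Union>k\<in>?N. coset_of n (e k) \<inter> F)" by (rule arg_cong)
    also have "\<dots> = (\<Sum>k\<in>?N. card (coset_of n (e k) \<inter> F))" by (rule card_line_union[OF e order_refl])
    finally have cF: "real (card F) = (\<Sum>k\<in>?N. real (card (coset_of n (e k) \<inter> F)))"
      by (simp only: of_nat_sum)
    have "(\<Sum>k\<in>?N. 2 * q k - 1) = 2 * (\<Sum>k\<in>?N. q k) - n"
      by (simp add: sum_subtractf sum_distrib_left)
    also have "(\<Sum>k\<in>?N. q k) = n * (real (card F) / fact n)"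
      unfolding cF q_def by (simp add: sum_distrib_right[symmetric] sum_divide_distrib[symmetric])
    finally have s: "(\<Sum>k\<in>?N. 2 * q k - 1) = n * (2 * (real (card F) / fact n) - 1)"
      by (simp add: algebra_simps)
    with pavg_sign[OF F] \<kappa> show ?thesis by simp
  qed
  have "(\<Sum>k\<in>?N. 2 * q k - 1) = (\<Sum>k\<in>?N. \<kappa> + \<beta> k)" by (rule sum.cong[OF refl q])
  hence sb: "(\<Sum>k\<in>?N. \<beta> k) = 0" unfolding sumq by (simp add: sum.distrib)
  define v where "v = (1 - \<kappa>\<^sup>2) / 2"
  have "(\<Sum>k\<in>?N. 2 * (q k * (1 - q k))) = (\<Sum>k\<in>?N. v - \<kappa> * \<beta> k - (\<beta> k)\<^sup>2 / 2)"
  proof (rule sum.cong[OF refl])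
    fix k assume "k \<in> ?N"
    have "2 * (q k * (1 - q k)) = (1 - (2 * q k - 1)\<^sup>2) / 2"
      by (simp add: power2_eq_square algebra_simps)
    thus "2 * (q k * (1 - q k)) = v - \<kappa> * \<beta> k - (\<beta> k)\<^sup>2 / 2"
      unfolding q[OF \<open>k \<in> ?N\<close>] v_def by (simp add: power2_eq_square field_simps)
  qed
  also have "\<dots> = n * v - \<kappa> * (\<Sum>k\<in>?N. \<beta> k) - (\<Sum>k\<in>?N. (\<beta> k)\<^sup>2) / 2"
    unfolding sum_subtractf sum_distrib_left[symmetric] sum_divide_distrib[symmetric] by simp
  also have "\<dots> = (n * (1 - \<kappa>\<^sup>2) - (\<Sum>k\<in>?N. (\<beta> k)\<^sup>2)) / 2"
    unfolding sb v_def by (simp add: field_simps)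
  finally have main: "(\<Sum>k\<in>?N. 2 * (q k * (1 - q k))) / n = (1 - \<kappa>\<^sup>2 - (\<Sum>k\<in>?N. (\<beta> k)\<^sup>2) / n) / 2"
    using n2 by (simp add: field_simps)
  have "(\<Sum>k\<in>?N. (B k)\<^sup>2) / (real n - 1) \<le> (\<Sum>k\<in>?N. (\<beta> k)\<^sup>2) / n"
  proof -
    have r: "1 / (real n - 1) \<le> (n / (real n - 1))\<^sup>2 / n"
    proof -
      have "(n / (real n - 1))\<^sup>2 / n = n / (real n - 1) * (1 / (real n - 1))"
        using n2 by (simp add: power2_eq_square)
      moreover have "1 * (1 / (real n - 1)) \<le> n / (real n - 1) * (1 / (real n - 1))"
        using n2 by (intro mult_right_mono) auto
      ultimately show ?thesis by simp
    qed
    have "(\<Sum>k\<in>?N. (B k)\<^sup>2) * (1 / (real n - 1)) \<le> (\<Sum>k\<in>?N. (B k)\<^sup>2) * ((n / (real n - 1))\<^sup>2 / n)"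
      by (intro mult_left_mono r sum_nonneg) auto
    also have "\<dots> = (\<Sum>k\<in>?N. (\<beta> k)\<^sup>2) / n"
      unfolding \<beta>_def power_mult_distrib sum_distrib_right[symmetric] by simp
    finally show ?thesis by simp
  qed
  moreover obtain J where J: "J \<subseteq> ?N"
    "symdist n (\<Union>k\<in>J. coset_of n (e k)) F \<le> (\<Sum>k\<in>?N. 2 * (q k * (1 - q k))) / n"
    using line_majority[OF e F n1] unfolding q_def by blast
  \<comment> \<open>Nonnegativity allows the factor 1/2 of \<open>main\<close> to be
    discarded.\<close>
  moreover have "0 \<le> symdist n (\<Union>k\<in>J. coset_of n (e k)) F" by (simp add: symdist_def)
  ultimately show thesis using that[of J] main unfolding B_def by argo
qed

text \<open>\<open>dominant_line\<close> is applied to the normalised squares of \<open>b\<close>,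
  whose total is the variance of the linear part. The bound on nonconflicting mass supplies
  \<delta>, with 4 * 2160 = 8640, and \<open>big\<close> says that it is small against the squared
  total.\<close>

lemma dominant_line_exists:
  fixes b :: "nat \<Rightarrow> nat \<Rightarrow> real"
  assumes n4: "n \<ge> 4" and sgn: "\<And>p. p permutes {1..n} \<Longrightarrow> f p \<in> {-1, 1}"
    and row: "\<forall>i\<in>{1..n}. (\<Sum>j\<in>{1..n}. b i j) = 0" and col: "\<forall>j\<in>{1..n}. (\<Sum>i\<in>{1..n}. b i j) = 0"
    and \<epsilon>: "\<epsilon> = pavg {1..n} (\<lambda>p. (f p - (\<kappa> + (\<Sum>i\<in>{1..n}. b i (p i))))\<^sup>2)"
    and marg: "\<forall>i\<in>{1..n}. \<forall>j\<in>{1..n}. pavg {1..n} (\<lambda>p. of_bool (p i = j) * f p) = \<kappa> / n + b i j / (real n - 1)"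
    and W: "(\<Sum>i\<in>{1..n}. \<Sum>j\<in>{1..n}. (b i j)\<^sup>2) / (real n - 1) = 1 - \<kappa>\<^sup>2 - \<epsilon>"
    and \<kappa>: "\<bar>\<kappa>\<bar> \<le> 1" and \<eta>: "0 < \<eta>" "\<eta> \<le> 1 - \<kappa>\<^sup>2 - \<epsilon>"
    and big: "8640 * (\<epsilon> + 1 / n) < \<eta>\<^sup>2" and eta1: "\<eta> \<le> 1"
  obtains e where "is_line n e"
    "1 - \<kappa>\<^sup>2 - (\<Sum>k\<in>{1..n}. (b (fst (e k)) (snd (e k)))\<^sup>2) / (real n - 1) \<le> \<epsilon> + 8640 * (\<epsilon> + 1 / n) / \<eta>"
proof -
  let ?N = "{1..n}"
  define w where "w i j = (b i j)\<^sup>2 / (real n - 1)" for i j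
  define V where "V = 1 - \<kappa>\<^sup>2 - \<epsilon>"
  define \<delta> where "\<delta> = 2160 * (\<epsilon> + 1 / n)"
  have n1: "real n - 1 > 0" using n4 by simp
  have \<epsilon>0: "0 \<le> \<epsilon>" unfolding \<epsilon> by (intro pavg_nonneg zero_le_power2)
  have Vw: "V = (\<Sum>i\<in>?N. \<Sum>j\<in>?N. w i j)"
    using W by (simp add: V_def w_def sum_divide_distrib)
  have w0: "0 \<le> w i j" for i j using n1 by (simp add: w_def)
  \<comment> \<open>The integrals of \<open>f\<close> and of \<kappa> over a 1-coset are each at
    most \<open>1 / n\<close> in absolute value, so \<open>b i j / (n - 1)\<close> is at most
    \<open>2 / n\<close>: no single entry is heavy.\<close>
  have bound: "w i j \<le> 4 / n" if ij: "i \<in> ?N" "j \<in> ?N" for i j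
  proof -
    have "\<bar>pavg ?N (\<lambda>p. of_bool (p i = j) * f p)\<bar> \<le> 1 / n"
    proof -
      have one: "pavg ?N (\<lambda>p. of_bool (p i = j)) = 1 / n"
        using card_coset1[OF ij] unfolding pavg_of_bool coset1_def by simp
      have "pavg ?N (\<lambda>p. of_bool (p i = j) * f p) \<le> pavg ?N (\<lambda>p. of_bool (p i = j))"
        using sgn by (intro pavg_mono) fastforce
      moreover have "pavg ?N (\<lambda>p. (-1) * of_bool (p i = j)) \<le> pavg ?N (\<lambda>p. of_bool (p i = j) * f p)"
        using sgn by (intro pavg_mono) fastforce
      ultimately show ?thesis unfolding pavg_cmult one by (simp add: abs_le_iff)
    qed
    moreover have "\<bar>\<kappa> / n\<bar> \<le> 1 / n" using \<kappa> by (simp add: divide_right_mono)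
    moreover have "pavg ?N (\<lambda>p. of_bool (p i = j) * f p) = \<kappa> / n + b i j / (real n - 1)"
      using marg ij by blast
    ultimately have "\<bar>b i j / (real n - 1)\<bar> \<le> 2 * (1 / n)" by linarith
    hence "\<bar>b i j / (real n - 1)\<bar> \<le> 2 / n" by simp
    hence "(b i j / (real n - 1))\<^sup>2 \<le> (2 / n)\<^sup>2" by (metis abs_ge_zero power2_abs power_mono)
    hence "(b i j / (real n - 1))\<^sup>2 * (real n - 1) \<le> (2 / n)\<^sup>2 * (real n - 1)"
      using n1 by (intro mult_right_mono) auto
    also have "\<dots> \<le> (2 / n)\<^sup>2 * n" by (intro mult_left_mono) auto
    also have "\<dots> = 4 / n" using n4 by (simp add: power2_eq_square)
    finally show ?thesis using n1 by (simp add: w_def power2_eq_square)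
  qed
  have V0: "0 < V" "\<eta> \<le> V" using \<eta> by (auto simp: V_def)
  have \<eta>2: "\<eta>\<^sup>2 \<le> V\<^sup>2" using V0 \<eta> by (intro power_mono) auto
  have "\<eta>\<^sup>2 \<le> \<eta>" using \<eta> eta1 by (simp add: power2_eq_square mult_le_cancel_left1)
  \<comment> \<open>Here \<open>big\<close> is used through
    \<open>8640 / n < \<eta>\<^sup>2 \<le> \<eta> \<le> V\<close>, far more than the required
    \<open>32 / n \<le> V\<close>.\<close>
  hence small: "8 * (4 / n) \<le> V" using big V0 \<epsilon>0 by (simp add: algebra_simps)
  have NC: "(\<Sum>i\<in>?N. \<Sum>j\<in>?N. w i j * (\<Sum>k\<in>?N - {i}. \<Sum>l\<in>?N - {j}. w k l)) \<le> \<delta>"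
  proof -
    have S: "(\<Sum>i\<in>?N. \<Sum>j\<in>?N. (b i j)\<^sup>2) \<le> card ?N"
    proof -
      have "(\<Sum>i\<in>?N. \<Sum>j\<in>?N. (b i j)\<^sup>2) = (1 - \<kappa>\<^sup>2 - \<epsilon>) * (real n - 1)"
        using W n1 by (simp add: field_simps)
      also have "\<dots> \<le> 1 * (real n - 1)"
        using \<epsilon>0 n1 zero_le_power2[of \<kappa>] by (intro mult_right_mono) linarith+
      finally show ?thesis by simp
    qed
    have "(\<Sum>i\<in>?N. \<Sum>j\<in>?N. w i j * (\<Sum>k\<in>?N - {i}. \<Sum>l\<in>?N - {j}. w k l))
      = (\<Sum>i\<in>?N. \<Sum>j\<in>?N. (b i j)\<^sup>2 * (\<Sum>k\<in>?N - {i}. \<Sum>l\<in>?N - {j}. (b k l)\<^sup>2)) / (real n - 1)\<^sup>2"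
      unfolding w_def sum_divide_distrib[symmetric] times_divide_times_eq power2_eq_square[of "real n - 1"] ..
    also have "\<dots> \<le> 2160 * \<epsilon> + 216 / n"
      using nonconflicting_mass_le[of ?N b f \<kappa>] n4 row col S sgn unfolding \<epsilon> by simp
    also have "\<dots> \<le> \<delta>" by (simp add: \<delta>_def algebra_simps divide_right_mono)
    finally show ?thesis .
  qed
  have "4 * \<delta> < V\<^sup>2" using big \<eta>2 by (simp add: \<delta>_def)
  hence "(\<exists>i\<in>?N. V - (\<Sum>j\<in>?N. w i j) \<le> 4 * \<delta> / V) \<or> (\<exists>j\<in>?N. V - (\<Sum>i\<in>?N. w i j) \<le> 4 * \<delta> / V)"
    by (intro dominant_line[where m = "4 / n"] w0 bound Vw V0(1) small NC) simp_all
  hence "\<exists>e. is_line n e \<and> V - (\<Sum>k\<in>?N. w (fst (e k)) (snd (e k))) \<le> 4 * \<delta> / V"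
  proof (elim disjE bexE)
    fix i assume "i \<in> ?N" "V - (\<Sum>j\<in>?N. w i j) \<le> 4 * \<delta> / V"
    thus ?thesis by (intro exI[of _ "\<lambda>k. (i, k)"]) (auto simp: is_line_def)
  next
    fix j assume "j \<in> ?N" "V - (\<Sum>i\<in>?N. w i j) \<le> 4 * \<delta> / V"
    thus ?thesis by (intro exI[of _ "\<lambda>k. (k, j)"]) (auto simp: is_line_def)
  qed
  then obtain e where e: "is_line n e" "V - (\<Sum>k\<in>?N. w (fst (e k)) (snd (e k))) \<le> 4 * \<delta> / V" by blast
  have "4 * \<delta> / V \<le> 4 * \<delta> / \<eta>"
    using V0 \<eta> \<epsilon>0 by (intro divide_left_mono) (auto simp: \<delta>_def)
  hence "1 - \<kappa>\<^sup>2 - (\<Sum>k\<in>?N. w (fst (e k)) (snd (e k))) \<le> \<epsilon> + 8640 * (\<epsilon> + 1 / n) / \<eta>"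
    using e(2) unfolding V_def \<delta>_def by simp
  with e(1) that show thesis by (simp add: w_def sum_divide_distrib)
qed

text \<open>If \<open>\<eta>\<^sup>2\<close> is below the error, the empty or the full family is good enough.\<close>

lemma dictator_approximation:
  fixes n :: nat and c :: real
  assumes n2: "n \<ge> 2" and F: "F \<subseteq> Sn n" and cF: "real (card F) = c * fact n"
    and c: "0 < c" "c < 1" and proj: "is_proj_U1 n (\<lambda>p. 2 * chi F p - 1) f1"
  defines "\<epsilon> \<equiv> expect n (\<lambda>p. (2 * chi F p - 1 - f1 p)\<^sup>2)"
  defines "\<eta> \<equiv> min c (1 - c)"
  obtains e J where "is_line n e" "J \<subseteq> {1..n}"
    "\<eta> * symdist n (\<Union>k\<in>J. coset_of n (e k)) F \<le> 8641 * (\<epsilon> + 1 / n)" "0 \<le> \<epsilon>" "\<epsilon> \<le> 1"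
proof -
  let ?N = "{1..n}" and ?f = "\<lambda>p. 2 * chi F p - 1 :: real"
  have sgn: "?f p \<in> {-1, 1}" if "p permutes ?N" for p by (simp add: chi_def)
  define \<kappa> where "\<kappa> = pavg ?N ?f"
  obtain b where row: "\<forall>i\<in>?N. (\<Sum>j\<in>?N. b i j) = 0" and col: "\<forall>j\<in>?N. (\<Sum>i\<in>?N. b i j) = 0"
    and eps: "\<epsilon> = pavg ?N (\<lambda>p. (?f p - (\<kappa> + (\<Sum>i\<in>?N. b i (p i))))\<^sup>2)"
    and marg: "\<forall>i\<in>?N. \<forall>j\<in>?N. pavg ?N (\<lambda>p. of_bool (p i = j) * ?f p) = \<kappa> / n + b i j / (real n - 1)"
    and W: "(\<Sum>i\<in>?N. \<Sum>j\<in>?N. (b i j)\<^sup>2) / (real n - 1) = 1 - \<kappa>\<^sup>2 - \<epsilon>"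
    unfolding \<kappa>_def \<epsilon>_def by (rule projection_U1[OF n2 proj sgn])
  have \<epsilon>0: "0 \<le> \<epsilon>" unfolding eps by (intro pavg_nonneg zero_le_power2)
  have "0 \<le> 1 - \<kappa>\<^sup>2 - \<epsilon>" unfolding W[symmetric] using n2
    by (intro divide_nonneg_nonneg sum_nonneg) auto
  hence \<epsilon>1: "\<epsilon> \<le> 1" using zero_le_power2[of \<kappa>] by linarith
  have \<kappa>c: "\<kappa> = 2 * c - 1" using pavg_sign[OF F] by (simp add: \<kappa>_def cF)
  have \<eta>: "0 < \<eta>" "\<eta> \<le> 1 / 2" using c by (auto simp: \<eta>_def min_def)
  \<comment> \<open>The variance of \<open>f\<close> is \<open>4 * c * (1 - c)\<close>, and the
    larger of \<open>c\<close> and \<open>1 - c\<close> is at least 1/2.\<close>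
  have V2: "2 * \<eta> \<le> 1 - \<kappa>\<^sup>2"
  proof -
    have "1 - \<kappa>\<^sup>2 = 4 * (\<eta> * (1 - \<eta>))"
      unfolding \<kappa>c \<eta>_def by (auto simp: min_def power2_eq_square algebra_simps)
    moreover have "\<eta> * (1 / 2) \<le> \<eta> * (1 - \<eta>)" using \<eta> by (intro mult_left_mono) auto
    ultimately show ?thesis by simp
  qed
  let ?x = "\<epsilon> + 1 / n"
  have x0: "0 \<le> ?x" using \<epsilon>0 by simp
  show thesis
  proof (cases "\<eta>\<^sup>2 \<le> 8640 * ?x")
    case True
    \<comment> \<open>Any line serves: its empty union is at distance \<open>c\<close> from
      \<open>F\<close> and its full union, all of \<open>Sn n\<close>, at distance
      \<open>1 - c\<close>. The smaller of the two is \<eta>.\<close>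
    have line: "is_line n (\<lambda>k. (1, k))" using n2 by (auto simp: is_line_def)
    obtain J where J: "J \<subseteq> ?N" "symdist n (\<Union>k\<in>J. coset_of n ((\<lambda>k. (1, k)) k)) F \<le> \<eta>"
    proof (cases "c \<le> 1 / 2")
      case True
      have "symdist n (\<Union>k\<in>{}. coset_of n ((\<lambda>k. (1, k)) k)) F = c"
        by (simp add: symdist_def cF)
      thus thesis using that[of "{}"] True by (simp add: \<eta>_def)
    next
      case False
      have "(Sn n - F) \<union> (F - Sn n) = Sn n - F" using F by blast
      hence "card ((Sn n - F) \<union> (F - Sn n)) = card (Sn n) - card F"
        using card_Diff_subset[OF finite_subset[OF F finite_Sn] F] by simp
      moreover have "card F \<le> card (Sn n)" by (rule card_mono[OF finite_Sn F])
      ultimately have "symdist n (Sn n) F = 1 - c"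
        by (simp add: symdist_def of_nat_diff card_Sn cF diff_divide_distrib)
      hence "symdist n (\<Union>k\<in>?N. coset_of n ((\<lambda>k. (1, k)) k)) F = 1 - c"
        using line_cosets(4)[OF line] by simp
      thus thesis using that[of ?N] False by (simp add: \<eta>_def)
    qed
    have "\<eta> * symdist n (\<Union>k\<in>J. coset_of n ((\<lambda>k. (1, k)) k)) F \<le> \<eta> * \<eta>"
      using J(2) \<eta> by (intro mult_left_mono) auto
    hence "\<eta> * symdist n (\<Union>k\<in>J. coset_of n ((\<lambda>k. (1, k)) k)) F \<le> 8641 * ?x"
      using True x0 by (simp add: power2_eq_square)
    thus thesis using that[OF line J(1)] \<epsilon>0 \<epsilon>1 by blast
  next
    case False
    hence big: "8640 * ?x < \<eta>\<^sup>2" by simp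
    have \<eta>2: "\<eta>\<^sup>2 \<le> \<eta>" "\<eta>\<^sup>2 \<le> 1" using \<eta> by (simp_all add: power2_eq_square mult_le_cancel_left1 mult_le_one)
    \<comment> \<open>For smaller \<open>n\<close> the term \<open>8640 / n\<close> alone exceeds 1,
      contradicting \<open>big\<close>.\<close>
    have "n \<ge> 4"
    proof (rule ccontr)
      assume "\<not> n \<ge> 4"
      hence "1 / 4 \<le> 1 / real n" using n2 by (intro divide_left_mono) auto
      thus False using big \<eta>2 \<epsilon>0 by simp
    qed
    have "8640 * \<epsilon> \<le> 8640 * ?x" by simp
    hence "\<epsilon> \<le> \<eta>" using big \<eta>2 \<epsilon>0 by linarith
    hence V: "\<eta> \<le> 1 - \<kappa>\<^sup>2 - \<epsilon>" using V2 by simp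
    have "\<bar>\<kappa>\<bar> \<le> 1" using c by (simp add: \<kappa>c abs_le_iff)
    then obtain e where e: "is_line n e" "1 - \<kappa>\<^sup>2 - (\<Sum>k\<in>?N. (b (fst (e k)) (snd (e k)))\<^sup>2) / (real n - 1)
       \<le> \<epsilon> + 8640 * ?x / \<eta>"
      using dominant_line_exists[OF \<open>n \<ge> 4\<close> sgn row col eps marg W _ \<eta>(1) V big] \<eta> by auto
    obtain J where J: "J \<subseteq> ?N" "symdist n (\<Union>k\<in>J. coset_of n (e k)) F
       \<le> 1 - \<kappa>\<^sup>2 - (\<Sum>k\<in>?N. (b (fst (e k)) (snd (e k)))\<^sup>2) / (real n - 1)"
      using line_approximation[OF e(1) F n2 \<kappa>_def marg] by blast
    have "\<eta> * symdist n (\<Union>k\<in>J. coset_of n (e k)) F \<le> \<eta> * (\<epsilon> + 8640 * ?x / \<eta>)"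
      using J(2) e(2) \<eta> by (intro mult_left_mono) auto
    also have "\<dots> = \<eta> * \<epsilon> + 8640 * ?x" using \<eta> by (simp add: field_simps)
    also have "\<dots> \<le> 1 * \<epsilon> + 8640 * ?x" using \<eta> \<epsilon>0 by (intro add_mono mult_right_mono) auto
    \<comment> \<open>The single \<epsilon> separating \<open>1 - \<kappa>\<^sup>2\<close> from the
      variance of the projection is absorbed here.\<close>
    also have "\<dots> \<le> 8641 * ?x" by (simp add: divide_right_mono)
    finally show thesis using that[OF e(1) J(1)] \<epsilon>0 \<epsilon>1 by blast
  qed
qed

text \<open>The argument yields the linear rate \<epsilon> + 1/n, which for \<epsilon> in [0, 1] is
  stronger than the rate with exponents 1/7 and 1/3.\<close>

lemma rate_le:
  assumes "0 \<le> (\<epsilon>::real)" "\<epsilon> \<le> 1" "n \<ge> (1::nat)"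
  shows "\<epsilon> + 1 / n \<le> \<epsilon> powr (1/7) + 1 / real n powr (1/3)" "1 / n \<le> \<epsilon> powr (1/7) + 1 / real n powr (1/3)"
proof -
  have "\<epsilon> \<le> \<epsilon> powr (1/7)"
  proof (cases "\<epsilon> = 0")
    case False
    thus ?thesis using assms powr_mono'[of "1/7" 1 \<epsilon>] by simp
  qed simp
  moreover have "real n powr (1/3) \<le> real n" using assms powr_mono[of "1/3" 1 "real n"] by simp
  hence "1 / n \<le> 1 / real n powr (1/3)" using assms by (intro divide_left_mono) auto
  ultimately show "\<epsilon> + 1 / n \<le> \<epsilon> powr (1/7) + 1 / real n powr (1/3)"
    and "1 / n \<le> \<epsilon> powr (1/7) + 1 / real n powr (1/3)" using assms by simp_all
qed

theorem theorem1:
  shows "\<exists>C::real. C > 0 \<and>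
    (\<forall>(n::nat) (F::(nat \<Rightarrow> nat) set) (c::real) f1.
       n \<ge> 1 \<longrightarrow> F \<subseteq> Sn n \<longrightarrow> real (card F) = c * fact n \<longrightarrow> 0 < c \<longrightarrow> c < 1 \<longrightarrow>
       is_proj_U1 n (\<lambda>p. 2 * chi F p - 1) f1 \<longrightarrow>
       (let f = (\<lambda>p. 2 * chi F p - 1 :: real);
            \<epsilon> = expect n (\<lambda>p. (f p - f1 p)^2);
            \<eta> = min c (1 - c)
        in \<exists>(G::(nat \<Rightarrow> nat) set) (d::real) (P::(nat \<times> nat) set).
             P \<subseteq> {1..n} \<times> {1..n} \<and>
             real (card P) = d * real n \<and>
             (\<forall>x\<in>P. \<forall>y\<in>P. x \<noteq> y \<longrightarrow>
                 coset1 n (fst x) (snd x) \<inter> coset1 n (fst y) (snd y) = {}) \<and>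
             G = (\<Union>x\<in>P. coset1 n (fst x) (snd x)) \<and>
             \<bar>d - c\<bar> \<le> C * (\<epsilon> powr (1/7) + 1 / real n powr (1/3)) \<and>
             real (card ((G - F) \<union> (F - G))) / fact n
               \<le> C / \<eta> * (\<epsilon> powr (1/7) + 1 / real n powr (1/3))))"
proof (rule exI[of _ 17283], intro conjI allI impI)
  fix n :: nat and F :: "(nat \<Rightarrow> nat) set" and c :: real and f1
  assume n: "n \<ge> 1" and F: "F \<subseteq> Sn n" and cF: "real (card F) = c * fact n" and c: "0 < c" "c < 1"
    and proj: "is_proj_U1 n (\<lambda>p. 2 * chi F p - 1) f1"
  define \<epsilon> where "\<epsilon> = expect n (\<lambda>p. (2 * chi F p - 1 - f1 p)\<^sup>2)"
  define \<eta> where "\<eta> = min c (1 - c)"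
  let ?r = "\<epsilon> powr (1/7) + 1 / real n powr (1/3)"
  \<comment> \<open>For \<open>n = 1\<close> the cardinality of \<open>F\<close> would be
    \<open>c\<close>, strictly between 0 and 1.\<close>
  have n2: "n \<ge> 2"
  proof (rule ccontr)
    assume "\<not> n \<ge> 2"
    hence "n = 1" using n by simp
    hence "real (card F) = c" using cF by simp
    hence "0 < card F" "card F < 1" using c by (metis of_nat_0_less_iff, metis of_nat_less_1_iff)
    thus False by simp
  qed
  obtain e J where e: "is_line n e" and J: "J \<subseteq> {1..n}"
    and D: "\<eta> * symdist n (\<Union>k\<in>J. coset_of n (e k)) F \<le> 8641 * (\<epsilon> + 1 / n)" and \<epsilon>: "0 \<le> \<epsilon>" "\<epsilon> \<le> 1"
    unfolding \<epsilon>_def \<eta>_def by (rule dictator_approximation[OF n2 F cF c proj])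
  have \<eta>: "0 < \<eta>" "\<eta> \<le> 1" using c by (auto simp: \<eta>_def)
  obtain K where K: "K \<subseteq> {1..n}" and dK: "\<bar>real (card K) / n - c\<bar> \<le> 1 / n"
    and GK: "symdist n (\<Union>k\<in>K. coset_of n (e k)) F \<le> 2 * symdist n (\<Union>k\<in>J. coset_of n (e k)) F + 1 / n"
    by (rule line_rounding[OF e J F cF c n order_refl])
  note rate = rate_le[OF \<epsilon> n]
  have d: "\<bar>real (card K) / n - c\<bar> \<le> 17283 * ?r" using dK rate \<epsilon> by (smt (verit) divide_nonneg_nonneg of_nat_0_le_iff)
  have "\<eta> * symdist n (\<Union>k\<in>K. coset_of n (e k)) F
    \<le> \<eta> * (2 * symdist n (\<Union>k\<in>J. coset_of n (e k)) F + 1 / n)"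
    using GK \<eta> by (intro mult_left_mono) auto
  also have "\<dots> = 2 * (\<eta> * symdist n (\<Union>k\<in>J. coset_of n (e k)) F) + \<eta> * (1 / n)"
    by (simp add: algebra_simps)
  also have "\<dots> \<le> 2 * (8641 * (\<epsilon> + 1 / n)) + 1 * (1 / n)"
    using D \<eta> by (intro add_mono mult_left_mono mult_right_mono) auto
  \<comment> \<open>Rounding doubles 8641 to 17282 and adds one more \<open>1 / n\<close>, whence
    the constant 17283.\<close>
  also have "\<dots> = 17282 * (\<epsilon> + 1 / n) + 1 / n" by simp
  also have "\<dots> \<le> 17282 * ?r + ?r" by (rule add_mono[OF mult_left_mono[OF rate(1)] rate(2)]) simp
  also have "\<dots> = 17283 * ?r" by simp
  finally have S: "symdist n (\<Union>k\<in>K. coset_of n (e k)) F \<le> 17283 / \<eta> * ?r"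
    using \<eta> by (simp add: field_simps)
  have "card (e ` K) = card K" using line_cosets(1)[OF e] by (simp add: card_image inj_on_subset)
  hence cP: "real (card (e ` K)) = real (card K) / n * real n" using n by simp
  have P: "e ` K \<subseteq> {1..n} \<times> {1..n}" using line_cosets(2)[OF e] K by blast
  have dis: "\<forall>x\<in>e ` K. \<forall>y\<in>e ` K. x \<noteq> y \<longrightarrow> coset_of n x \<inter> coset_of n y = {}"
  proof (intro ballI impI)
    fix x y assume "x \<in> e ` K" "y \<in> e ` K" "x \<noteq> y"
    then obtain k l where "x = e k" "y = e l" "k \<noteq> l" by blast
    thus "coset_of n x \<inter> coset_of n y = {}" using line_cosets(3)[OF e] by simp
  qed
  have G: "(\<Union>k\<in>K. coset_of n (e k)) = (\<Union>x\<in>e ` K. coset_of n x)" by simp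
  show "let f = (\<lambda>p. 2 * chi F p - 1 :: real);
            \<epsilon> = expect n (\<lambda>p. (f p - f1 p)^2);
            \<eta> = min c (1 - c)
        in \<exists>(G::(nat \<Rightarrow> nat) set) (d::real) (P::(nat \<times> nat) set).
             P \<subseteq> {1..n} \<times> {1..n} \<and>
             real (card P) = d * real n \<and>
             (\<forall>x\<in>P. \<forall>y\<in>P. x \<noteq> y \<longrightarrow>
                 coset1 n (fst x) (snd x) \<inter> coset1 n (fst y) (snd y) = {}) \<and>
             G = (\<Union>x\<in>P. coset1 n (fst x) (snd x)) \<and>
             \<bar>d - c\<bar> \<le> 17283 * (\<epsilon> powr (1/7) + 1 / real n powr (1/3)) \<and>
             real (card ((G - F) \<union> (F - G))) / fact n
               \<le> 17283 / \<eta> * (\<epsilon> powr (1/7) + 1 / real n powr (1/3))"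
    unfolding Let_def \<epsilon>_def[symmetric] \<eta>_def[symmetric]
    by (intro exI conjI) (rule P cP dis G d S[unfolded symdist_def])+
qed simp

end
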